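(* Consider a relational structure $\mathbb{A}$ in which, for every $k \in \{0,1,\ldots\}$, there are finitely many relations of arity $k$. If this structure has a decidable first-order theory, then there is an algorithm which, given two morphisms of the single-use category over $\mathbb{A}$ described by expressions using prime functions and combinators, decides whether they are the same morphism (i.e.~the same function).
   Context: Let $\mathbb{A}$ be a relational structure (relations only). Linear types are expressions built from $1$ and $\mathbb{A}$ using binary constructors $+$, $\&$, $\otimes$; each linear type $X$ denotes a set $S(X)$ with $S(1)$ a singleton, $S(\mathbb{A}) = \mathbb{A}$, $S(X+Y)$ the disjoint union, and $S(X\otimes Y) = S(X \& Y) = S(X)\times S(Y)$. Morphisms of the single-use category over $\mathbb{A}$ from $X$ to $Y$ are functions $S(X)\to S(Y)$ generated from prime functions by the combinators composition, and componentwise $+$, $\otimes$, $\&$. The prime functions are: equality test $\mathbb{A}\otimes\mathbb{A}\to 1+1$; constants $1 \to \mathbb{A}$; identity; commutativity/associativity of $\otimes$ and $+$; projections $X\otimes Y \to X$, $X \otimes Y \to Y$; $X \to X\otimes 1$; co-projections into $X+Y$; co-diagonal $X+X\to X$; $X\otimes(Y+Z)\to (X\otimes Y)+(X\otimes Z)$; diagonal $X \to X\&X$; projections $X\&Y\to X$, $X \& Y \to Y$; $X\otimes(Y\&Z)\to(X\otimes Y)\&(X\otimes Z)$; $x\&\mathrm{left}(y)\mapsto \mathrm{left}(x\&y)$, $x\&\mathrm{right}(z)\mapsto\mathrm{right}(x\&z)$; and for every $n$-ary relation $R$ of $\mathbb{A}$ the test $\mathbb{A}^n \to 1+1$ (power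 via $\otimes$) for $R$.
   Formalization: Constants 1→A are given by names from a fixed partial naming of elements, and the first-order theory assumed decidable is that of the structure with these named elements added as constants; for constant-free expressions it is the purely relational theory. *)

theory Defs
  imports Main "HOL-Library.Nat_Bijection" "HOL-Library.FuncSet"
begin

section \<open>Recursive functions and decision problems\<close>

text \<open>
  \<open>recursive n f\<close>: \<open>f\<close>, regarded as an \<open>n\<close>-ary function (only its values on lists of length
  \<open>n\<close> matter, see rule \<open>ext\<close>), is a total recursive function. Minimisation is applied to
  regular functions only; by Kleene's normal form theorem this yields exactly the total
  functions among the partial recursive ones.
\<close>

inductive recursive :: "nat \<Rightarrow> (nat list \<Rightarrow> nat) \<Rightarrow> bool" where
  zero: "recursive n (\<lambda>xs. 0)"
| succ: "recursive 1 (\<lambda>xs. Suc (hd xs))"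
| proj: "i < n \<Longrightarrow> recursive n (\<lambda>xs. xs ! i)"
| comp: "recursive (length gs) f \<Longrightarrow> (\<And>g. g \<in> set gs \<Longrightarrow> recursive n g) \<Longrightarrow>
    recursive n (\<lambda>xs. f (map (\<lambda>g. g xs) gs))"
| prim_rec: "recursive n f \<Longrightarrow> recursive (n + 2) g \<Longrightarrow>
    recursive (n + 1) (\<lambda>xs. rec_nat (f (tl xs)) (\<lambda>k r. g (k # r # tl xs)) (hd xs))"
| minimisation: "recursive (n + 1) f \<Longrightarrow> (\<And>xs. length xs = n \<Longrightarrow> \<exists>y. f (y # xs) = 0) \<Longrightarrow>
    recursive n (\<lambda>xs. LEAST y. f (y # xs) = 0)"
| ext: "recursive n f \<Longrightarrow> (\<And>xs. length xs = n \<Longrightarrow> f xs = g xs) \<Longrightarrow> recursive n g"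

text \<open>
  There is an algorithm which, given the code of an instance \<open>x \<in> I\<close>, decides whether \<open>P x\<close>.
  Nothing is required of its answers on numbers that do not code an instance.
\<close>

definition decidable_problem :: "('i \<Rightarrow> nat) \<Rightarrow> 'i set \<Rightarrow> ('i \<Rightarrow> bool) \<Rightarrow> bool" where
  "decidable_problem code I P \<longleftrightarrow>
     (\<exists>f. recursive 1 f \<and> (\<forall>x\<in>I. f [code x] = (if P x then 1 else 0)))"


section \<open>Relational structures and first-order logic\<close>

text \<open>
  Relation symbols are given to algorithms as pairs of an arity \<open>k\<close> and a name \<open>r \<in> rels M k\<close>.
\<close>

record 'a rel_structure =
  universe :: "'a set"
  rels :: "nat \<Rightarrow> nat set"
  rel :: "nat \<Rightarrow> nat \<Rightarrow> 'a list set"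

definition relational_structure :: "'a rel_structure \<Rightarrow> bool" where
  "relational_structure M \<longleftrightarrow>
     (\<forall>k. \<forall>r\<in>rels M k. \<forall>xs\<in>rel M k r. length xs = k \<and> set xs \<subseteq> universe M)"

text \<open>
  Elements of the structure occur in finite syntactic objects (as constants) through names:
  \<open>\<nu> c = Some a\<close> means that \<open>c\<close> is a name of \<open>a\<close>. Elements may have several names, or none.
\<close>

type_synonym 'a naming = "nat \<rightharpoonup> 'a"

datatype tm = Var nat | Cst nat

datatype fm =
    Eq tm tm
  | Rel nat nat "tm list"
  | Neg fm
  | Conj fm fm
  | Disj fm fm
  | Imp fm fm
  | Forall nat fm
  | Exists nat fm

primrec tm_val :: "'a naming \<Rightarrow> (nat \<Rightarrow> 'a) \<Rightarrow> tm \<Rightarrow> 'a" where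
  "tm_val \<nu> s (Var x) = s x"
| "tm_val \<nu> s (Cst c) = the (\<nu> c)"

primrec sat :: "'a rel_structure \<Rightarrow> 'a naming \<Rightarrow> (nat \<Rightarrow> 'a) \<Rightarrow> fm \<Rightarrow> bool" where
  "sat M \<nu> s (Eq t u) \<longleftrightarrow> tm_val \<nu> s t = tm_val \<nu> s u"
| "sat M \<nu> s (Rel k r ts) \<longleftrightarrow> map (tm_val \<nu> s) ts \<in> rel M k r"
| "sat M \<nu> s (Neg \<phi>) \<longleftrightarrow> \<not> sat M \<nu> s \<phi>"
| "sat M \<nu> s (Conj \<phi> \<psi>) \<longleftrightarrow> sat M \<nu> s \<phi> \<and> sat M \<nu> s \<psi>"
| "sat M \<nu> s (Disj \<phi> \<psi>) \<longleftrightarrow> sat M \<nu> s \<phi> \<or> sat M \<nu> s \<psi>"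
| "sat M \<nu> s (Imp \<phi> \<psi>) \<longleftrightarrow> (sat M \<nu> s \<phi> \<longrightarrow> sat M \<nu> s \<psi>)"
| "sat M \<nu> s (Forall x \<phi>) \<longleftrightarrow> (\<forall>a\<in>universe M. sat M \<nu> (s(x := a)) \<phi>)"
| "sat M \<nu> s (Exists x \<phi>) \<longleftrightarrow> (\<exists>a\<in>universe M. sat M \<nu> (s(x := a)) \<phi>)"

primrec tm_vars :: "tm \<Rightarrow> nat set" where
  "tm_vars (Var x) = {x}"
| "tm_vars (Cst c) = {}"

primrec free_vars :: "fm \<Rightarrow> nat set" where
  "free_vars (Eq t u) = tm_vars t \<union> tm_vars u"
| "free_vars (Rel k r ts) = (\<Union>t\<in>set ts. tm_vars t)"
| "free_vars (Neg \<phi>) = free_vars \<phi>"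
| "free_vars (Conj \<phi> \<psi>) = free_vars \<phi> \<union> free_vars \<psi>"
| "free_vars (Disj \<phi> \<psi>) = free_vars \<phi> \<union> free_vars \<psi>"
| "free_vars (Imp \<phi> \<psi>) = free_vars \<phi> \<union> free_vars \<psi>"
| "free_vars (Forall x \<phi>) = free_vars \<phi> - {x}"
| "free_vars (Exists x \<phi>) = free_vars \<phi> - {x}"

primrec wf_tm :: "'a naming \<Rightarrow> tm \<Rightarrow> bool" where
  "wf_tm \<nu> (Var x) \<longleftrightarrow> True"
| "wf_tm \<nu> (Cst c) \<longleftrightarrow> c \<in> dom \<nu>"

primrec wf_fm :: "'a rel_structure \<Rightarrow> 'a naming \<Rightarrow> fm \<Rightarrow> bool" where
  "wf_fm M \<nu> (Eq t u) \<longleftrightarrow> wf_tm \<nu> t \<and> wf_tm \<nu> u"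
| "wf_fm M \<nu> (Rel k r ts) \<longleftrightarrow> r \<in> rels M k \<and> length ts = k \<and> (\<forall>t\<in>set ts. wf_tm \<nu> t)"
| "wf_fm M \<nu> (Neg \<phi>) \<longleftrightarrow> wf_fm M \<nu> \<phi>"
| "wf_fm M \<nu> (Conj \<phi> \<psi>) \<longleftrightarrow> wf_fm M \<nu> \<phi> \<and> wf_fm M \<nu> \<psi>"
| "wf_fm M \<nu> (Disj \<phi> \<psi>) \<longleftrightarrow> wf_fm M \<nu> \<phi> \<and> wf_fm M \<nu> \<psi>"
| "wf_fm M \<nu> (Imp \<phi> \<psi>) \<longleftrightarrow> wf_fm M \<nu> \<phi> \<and> wf_fm M \<nu> \<psi>"
| "wf_fm M \<nu> (Forall x \<phi>) \<longleftrightarrow> wf_fm M \<nu> \<phi>"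
| "wf_fm M \<nu> (Exists x \<phi>) \<longleftrightarrow> wf_fm M \<nu> \<phi>"

definition sentences :: "'a rel_structure \<Rightarrow> 'a naming \<Rightarrow> fm set" where
  "sentences M \<nu> = {\<phi>. wf_fm M \<nu> \<phi> \<and> free_vars \<phi> = {}}"

text \<open>
  Truth of a sentence does not depend on the assignment \<open>s\<close>. Not requiring \<open>s\<close> to take values in
  the universe makes the definition correct for the empty structure as well.
\<close>

definition models :: "'a rel_structure \<Rightarrow> 'a naming \<Rightarrow> fm \<Rightarrow> bool" where
  "models M \<nu> \<phi> \<longleftrightarrow> (\<forall>s. sat M \<nu> s \<phi>)"

primrec code_tm :: "tm \<Rightarrow> nat" where
  "code_tm (Var x) = list_encode [0, x]"
| "code_tm (Cst c) = list_encode [1, c]"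

primrec code_fm :: "fm \<Rightarrow> nat" where
  "code_fm (Eq t u) = list_encode [0, code_tm t, code_tm u]"
| "code_fm (Rel k r ts) = list_encode [1, k, r, list_encode (map code_tm ts)]"
| "code_fm (Neg \<phi>) = list_encode [2, code_fm \<phi>]"
| "code_fm (Conj \<phi> \<psi>) = list_encode [3, code_fm \<phi>, code_fm \<psi>]"
| "code_fm (Disj \<phi> \<psi>) = list_encode [4, code_fm \<phi>, code_fm \<psi>]"
| "code_fm (Imp \<phi> \<psi>) = list_encode [5, code_fm \<phi>, code_fm \<psi>]"
| "code_fm (Forall x \<phi>) = list_encode [6, x, code_fm \<phi>]"
| "code_fm (Exists x \<phi>) = list_encode [7, x, code_fm \<phi>]"

text \<open>
  The first-order theory is that of the structure together with the named elements as constants.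
  For the naming without any names this is the theory in the purely relational language.
\<close>

definition decidable_fo_theory :: "'a rel_structure \<Rightarrow> 'a naming \<Rightarrow> bool" where
  "decidable_fo_theory M \<nu> \<longleftrightarrow> decidable_problem code_fm (sentences M \<nu>) (models M \<nu>)"


section \<open>Linear types\<close>

datatype lty =
    One
  | Atoms
  | Plus lty lty (infixr \<open>\<oplus>\<close> 65)
  | With lty lty (infixr \<open>\<sqinter>\<close> 70)
  | Tensor lty lty (infixr \<open>\<otimes>\<close> 75)

datatype 'a val = Unit | Atom 'a | Lft "'a val" | Rgt "'a val" | Tup "'a val" "'a val"

primrec elems :: "'a rel_structure \<Rightarrow> lty \<Rightarrow> 'a val set" where
  "elems M One = {Unit}"
| "elems M Atoms = Atom ` universe M"
| "elems M (X \<oplus> Y) = Lft ` elems M X \<union> Rgt ` elems M Y"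
| "elems M (X \<sqinter> Y) = {Tup x y |x y. x \<in> elems M X \<and> y \<in> elems M Y}"
| "elems M (X \<otimes> Y) = {Tup x y |x y. x \<in> elems M X \<and> y \<in> elems M Y}"

text \<open>The power \<open>\<bbbA>\<^sup>n\<close>, with \<open>\<bbbA>\<^sup>0 = 1\<close>, \<open>\<bbbA>\<^sup>1 = \<bbbA>\<close> and \<open>\<bbbA>\<^sup>n\<^sup>+\<^sup>1 = \<bbbA> \<otimes> \<bbbA>\<^sup>n\<close> for \<open>n > 0\<close>.\<close>

fun atoms_pow :: "nat \<Rightarrow> lty" where
  "atoms_pow 0 = One"
| "atoms_pow (Suc 0) = Atoms"
| "atoms_pow (Suc (Suc n)) = Atoms \<otimes> atoms_pow (Suc n)"

text \<open>On \<open>\<bbbA>\<^sup>n\<close>, the list of the \<open>n\<close> components of a tuple.\<close>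

primrec components :: "'a val \<Rightarrow> 'a list" where
  "components Unit = []"
| "components (Atom a) = [a]"
| "components (Lft x) = components x"
| "components (Rgt x) = components x"
| "components (Tup x y) = components x @ components y"


section \<open>The single-use category\<close>

text \<open>Prime functions are annotated with the types at which they are used.\<close>

datatype prime =
    EqTest
  | Const nat
  | RelTest nat nat
  | Ident lty
  | TensorComm lty lty
  | TensorAssoc lty lty lty
  | TensorAssocInv lty lty lty
  | PlusComm lty lty
  | PlusAssoc lty lty lty
  | PlusAssocInv lty lty lty
  | TensorFst lty lty
  | TensorSnd lty lty
  | TensorUnit lty
  | InLft lty lty
  | InRgt lty lty
  | Codiag lty
  | TensorPlusDistr lty lty lty
  | Diag lty
  | WithFst lty lty
  | WithSnd lty lty
  | TensorWithDistr lty lty lty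
  | WithPlusDistr lty lty lty

primrec prime_dom :: "prime \<Rightarrow> lty" where
  "prime_dom EqTest = Atoms \<otimes> Atoms"
| "prime_dom (Const c) = One"
| "prime_dom (RelTest k r) = atoms_pow k"
| "prime_dom (Ident X) = X"
| "prime_dom (TensorComm X Y) = X \<otimes> Y"
| "prime_dom (TensorAssoc X Y Z) = X \<otimes> (Y \<otimes> Z)"
| "prime_dom (TensorAssocInv X Y Z) = (X \<otimes> Y) \<otimes> Z"
| "prime_dom (PlusComm X Y) = X \<oplus> Y"
| "prime_dom (PlusAssoc X Y Z) = X \<oplus> (Y \<oplus> Z)"
| "prime_dom (PlusAssocInv X Y Z) = (X \<oplus> Y) \<oplus> Z"
| "prime_dom (TensorFst X Y) = X \<otimes> Y"
| "prime_dom (TensorSnd X Y) = X \<otimes> Y"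
| "prime_dom (TensorUnit X) = X"
| "prime_dom (InLft X Y) = X"
| "prime_dom (InRgt X Y) = Y"
| "prime_dom (Codiag X) = X \<oplus> X"
| "prime_dom (TensorPlusDistr X Y Z) = X \<otimes> (Y \<oplus> Z)"
| "prime_dom (Diag X) = X"
| "prime_dom (WithFst X Y) = X \<sqinter> Y"
| "prime_dom (WithSnd X Y) = X \<sqinter> Y"
| "prime_dom (TensorWithDistr X Y Z) = X \<otimes> (Y \<sqinter> Z)"
| "prime_dom (WithPlusDistr X Y Z) = X \<sqinter> (Y \<oplus> Z)"

primrec prime_cod :: "prime \<Rightarrow> lty" where
  "prime_cod EqTest = One \<oplus> One"
| "prime_cod (Const c) = Atoms"
| "prime_cod (RelTest k r) = One \<oplus> One"
| "prime_cod (Ident X) = X"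
| "prime_cod (TensorComm X Y) = Y \<otimes> X"
| "prime_cod (TensorAssoc X Y Z) = (X \<otimes> Y) \<otimes> Z"
| "prime_cod (TensorAssocInv X Y Z) = X \<otimes> (Y \<otimes> Z)"
| "prime_cod (PlusComm X Y) = Y \<oplus> X"
| "prime_cod (PlusAssoc X Y Z) = (X \<oplus> Y) \<oplus> Z"
| "prime_cod (PlusAssocInv X Y Z) = X \<oplus> (Y \<oplus> Z)"
| "prime_cod (TensorFst X Y) = X"
| "prime_cod (TensorSnd X Y) = Y"
| "prime_cod (TensorUnit X) = X \<otimes> One"
| "prime_cod (InLft X Y) = X \<oplus> Y"
| "prime_cod (InRgt X Y) = X \<oplus> Y"
| "prime_cod (Codiag X) = X"
| "prime_cod (TensorPlusDistr X Y Z) = (X \<otimes> Y) \<oplus> (X \<otimes> Z)"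
| "prime_cod (Diag X) = X \<sqinter> X"
| "prime_cod (WithFst X Y) = X"
| "prime_cod (WithSnd X Y) = Y"
| "prime_cod (TensorWithDistr X Y Z) = (X \<otimes> Y) \<sqinter> (X \<otimes> Z)"
| "prime_cod (WithPlusDistr X Y Z) = (X \<sqinter> Y) \<oplus> (X \<sqinter> Z)"

text \<open>Tests answer in \<open>1 + 1\<close>, whose left element stands for true.\<close>

definition truth_val :: "bool \<Rightarrow> 'a val" where
  "truth_val b = (if b then Lft Unit else Rgt Unit)"

primrec prime_fun ::
    "'a rel_structure \<Rightarrow> 'a naming \<Rightarrow> prime \<Rightarrow> 'a val \<Rightarrow> 'a val" where
  "prime_fun M \<nu> EqTest = (\<lambda>v. case v of Tup x y \<Rightarrow> truth_val (x = y))"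
| "prime_fun M \<nu> (Const c) = (\<lambda>v. Atom (the (\<nu> c)))"
| "prime_fun M \<nu> (RelTest k r) = (\<lambda>v. truth_val (components v \<in> rel M k r))"
| "prime_fun M \<nu> (Ident X) = (\<lambda>v. v)"
| "prime_fun M \<nu> (TensorComm X Y) = (\<lambda>v. case v of Tup x y \<Rightarrow> Tup y x)"
| "prime_fun M \<nu> (TensorAssoc X Y Z) =
     (\<lambda>v. case v of Tup x (Tup y z) \<Rightarrow> Tup (Tup x y) z)"
| "prime_fun M \<nu> (TensorAssocInv X Y Z) =
     (\<lambda>v. case v of Tup (Tup x y) z \<Rightarrow> Tup x (Tup y z))"
| "prime_fun M \<nu> (PlusComm X Y) = (\<lambda>v. case v of Lft x \<Rightarrow> Rgt x | Rgt y \<Rightarrow> Lft y)"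
| "prime_fun M \<nu> (PlusAssoc X Y Z) =
     (\<lambda>v. case v of Lft x \<Rightarrow> Lft (Lft x) | Rgt (Lft y) \<Rightarrow> Lft (Rgt y) | Rgt (Rgt z) \<Rightarrow> Rgt z)"
| "prime_fun M \<nu> (PlusAssocInv X Y Z) =
     (\<lambda>v. case v of Lft (Lft x) \<Rightarrow> Lft x | Lft (Rgt y) \<Rightarrow> Rgt (Lft y) | Rgt z \<Rightarrow> Rgt (Rgt z))"
| "prime_fun M \<nu> (TensorFst X Y) = (\<lambda>v. case v of Tup x y \<Rightarrow> x)"
| "prime_fun M \<nu> (TensorSnd X Y) = (\<lambda>v. case v of Tup x y \<Rightarrow> y)"
| "prime_fun M \<nu> (TensorUnit X) = (\<lambda>v. Tup v Unit)"
| "prime_fun M \<nu> (InLft X Y) = (\<lambda>v. Lft v)"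
| "prime_fun M \<nu> (InRgt X Y) = (\<lambda>v. Rgt v)"
| "prime_fun M \<nu> (Codiag X) = (\<lambda>v. case v of Lft x \<Rightarrow> x | Rgt x \<Rightarrow> x)"
| "prime_fun M \<nu> (TensorPlusDistr X Y Z) =
     (\<lambda>v. case v of Tup x (Lft y) \<Rightarrow> Lft (Tup x y) | Tup x (Rgt z) \<Rightarrow> Rgt (Tup x z))"
| "prime_fun M \<nu> (Diag X) = (\<lambda>v. Tup v v)"
| "prime_fun M \<nu> (WithFst X Y) = (\<lambda>v. case v of Tup x y \<Rightarrow> x)"
| "prime_fun M \<nu> (WithSnd X Y) = (\<lambda>v. case v of Tup x y \<Rightarrow> y)"
| "prime_fun M \<nu> (TensorWithDistr X Y Z) =
     (\<lambda>v. case v of Tup x (Tup y z) \<Rightarrow> Tup (Tup x y) (Tup x z))"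
| "prime_fun M \<nu> (WithPlusDistr X Y Z) =
     (\<lambda>v. case v of Tup x (Lft y) \<Rightarrow> Lft (Tup x y) | Tup x (Rgt z) \<Rightarrow> Rgt (Tup x z))"

primrec wf_prime :: "'a rel_structure \<Rightarrow> 'a naming \<Rightarrow> prime \<Rightarrow> bool" where
  "wf_prime M \<nu> EqTest \<longleftrightarrow> True"
| "wf_prime M \<nu> (Const c) \<longleftrightarrow> c \<in> dom \<nu>"
| "wf_prime M \<nu> (RelTest k r) \<longleftrightarrow> r \<in> rels M k"
| "wf_prime M \<nu> (Ident X) \<longleftrightarrow> True"
| "wf_prime M \<nu> (TensorComm X Y) \<longleftrightarrow> True"
| "wf_prime M \<nu> (TensorAssoc X Y Z) \<longleftrightarrow> True"
| "wf_prime M \<nu> (TensorAssocInv X Y Z) \<longleftrightarrow> True"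
| "wf_prime M \<nu> (PlusComm X Y) \<longleftrightarrow> True"
| "wf_prime M \<nu> (PlusAssoc X Y Z) \<longleftrightarrow> True"
| "wf_prime M \<nu> (PlusAssocInv X Y Z) \<longleftrightarrow> True"
| "wf_prime M \<nu> (TensorFst X Y) \<longleftrightarrow> True"
| "wf_prime M \<nu> (TensorSnd X Y) \<longleftrightarrow> True"
| "wf_prime M \<nu> (TensorUnit X) \<longleftrightarrow> True"
| "wf_prime M \<nu> (InLft X Y) \<longleftrightarrow> True"
| "wf_prime M \<nu> (InRgt X Y) \<longleftrightarrow> True"
| "wf_prime M \<nu> (Codiag X) \<longleftrightarrow> True"
| "wf_prime M \<nu> (TensorPlusDistr X Y Z) \<longleftrightarrow> True"
| "wf_prime M \<nu> (Diag X) \<longleftrightarrow> True"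
| "wf_prime M \<nu> (WithFst X Y) \<longleftrightarrow> True"
| "wf_prime M \<nu> (WithSnd X Y) \<longleftrightarrow> True"
| "wf_prime M \<nu> (TensorWithDistr X Y Z) \<longleftrightarrow> True"
| "wf_prime M \<nu> (WithPlusDistr X Y Z) \<longleftrightarrow> True"

datatype mexp =
    Prime prime
  | Comp mexp mexp
  | PlusMap mexp mexp
  | TensorMap mexp mexp
  | WithMap mexp mexp

primrec mdom :: "mexp \<Rightarrow> lty" where
  "mdom (Prime p) = prime_dom p"
| "mdom (Comp g f) = mdom f"
| "mdom (PlusMap f g) = mdom f \<oplus> mdom g"
| "mdom (TensorMap f g) = mdom f \<otimes> mdom g"
| "mdom (WithMap f g) = mdom f \<sqinter> mdom g"

primrec mcod :: "mexp \<Rightarrow> lty" where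
  "mcod (Prime p) = prime_cod p"
| "mcod (Comp g f) = mcod g"
| "mcod (PlusMap f g) = mcod f \<oplus> mcod g"
| "mcod (TensorMap f g) = mcod f \<otimes> mcod g"
| "mcod (WithMap f g) = mcod f \<sqinter> mcod g"

primrec wf_mexp :: "'a rel_structure \<Rightarrow> 'a naming \<Rightarrow> mexp \<Rightarrow> bool" where
  "wf_mexp M \<nu> (Prime p) \<longleftrightarrow> wf_prime M \<nu> p"
| "wf_mexp M \<nu> (Comp g f) \<longleftrightarrow> wf_mexp M \<nu> g \<and> wf_mexp M \<nu> f \<and> mcod f = mdom g"
| "wf_mexp M \<nu> (PlusMap f g) \<longleftrightarrow> wf_mexp M \<nu> f \<and> wf_mexp M \<nu> g"
| "wf_mexp M \<nu> (TensorMap f g) \<longleftrightarrow> wf_mexp M \<nu> f \<and> wf_mexp M \<nu> g"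
| "wf_mexp M \<nu> (WithMap f g) \<longleftrightarrow> wf_mexp M \<nu> f \<and> wf_mexp M \<nu> g"

primrec mexp_fun :: "'a rel_structure \<Rightarrow> 'a naming \<Rightarrow> mexp \<Rightarrow> 'a val \<Rightarrow> 'a val" where
  "mexp_fun M \<nu> (Prime p) = prime_fun M \<nu> p"
| "mexp_fun M \<nu> (Comp g f) = mexp_fun M \<nu> g \<circ> mexp_fun M \<nu> f"
| "mexp_fun M \<nu> (PlusMap f g) =
     (\<lambda>v. case v of Lft x \<Rightarrow> Lft (mexp_fun M \<nu> f x) | Rgt y \<Rightarrow> Rgt (mexp_fun M \<nu> g y))"
| "mexp_fun M \<nu> (TensorMap f g) =
     (\<lambda>v. case v of Tup x y \<Rightarrow> Tup (mexp_fun M \<nu> f x) (mexp_fun M \<nu> g y))"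
| "mexp_fun M \<nu> (WithMap f g) =
     (\<lambda>v. case v of Tup x y \<Rightarrow> Tup (mexp_fun M \<nu> f x) (mexp_fun M \<nu> g y))"

text \<open>
  The morphism described by an expression: domain, codomain, and function between the denoted
  sets. Since \<open>X \<otimes> Y\<close> and \<open>X & Y\<close> denote the same set, the function alone does not determine
  the types.
\<close>

definition morphism ::
    "'a rel_structure \<Rightarrow> 'a naming \<Rightarrow> mexp \<Rightarrow> lty \<times> lty \<times> ('a val \<Rightarrow> 'a val)" where
  "morphism M \<nu> e = (mdom e, mcod e, restrict (mexp_fun M \<nu> e) (elems M (mdom e)))"

lemma components_atoms_pow:
  "v \<in> elems M (atoms_pow n) \<Longrightarrow>
     length (components v) = n \<and> set (components v) \<subseteq> universe M"
  by (induction n arbitrary: v rule: atoms_pow.induct) fastforce+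

lemma prime_fun_elems:
  assumes "ran \<nu> \<subseteq> universe M" "wf_prime M \<nu> p" "v \<in> elems M (prime_dom p)"
  shows "prime_fun M \<nu> p v \<in> elems M (prime_cod p)"
  using assms by (cases p) (auto simp: truth_val_def ran_def)

lemma mexp_fun_elems:
  assumes "ran \<nu> \<subseteq> universe M" "wf_mexp M \<nu> e"
  shows "restrict (mexp_fun M \<nu> e) (elems M (mdom e)) \<in> elems M (mdom e) \<rightarrow>\<^sub>E elems M (mcod e)"
proof -
  have "mexp_fun M \<nu> e v \<in> elems M (mcod e)" if "v \<in> elems M (mdom e)" for v
    using assms that by (induction e arbitrary: v) (auto simp: prime_fun_elems)
  then show ?thesis by auto
qed

primrec code_lty :: "lty \<Rightarrow> nat" where
  "code_lty One = list_encode [0]"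
| "code_lty Atoms = list_encode [1]"
| "code_lty (X \<oplus> Y) = list_encode [2, code_lty X, code_lty Y]"
| "code_lty (X \<sqinter> Y) = list_encode [3, code_lty X, code_lty Y]"
| "code_lty (X \<otimes> Y) = list_encode [4, code_lty X, code_lty Y]"

primrec code_prime :: "prime \<Rightarrow> nat" where
  "code_prime EqTest = list_encode [0]"
| "code_prime (Const c) = list_encode [1, c]"
| "code_prime (RelTest k r) = list_encode [2, k, r]"
| "code_prime (Ident X) = list_encode [3, code_lty X]"
| "code_prime (TensorComm X Y) = list_encode [4, code_lty X, code_lty Y]"
| "code_prime (TensorAssoc X Y Z) = list_encode [5, code_lty X, code_lty Y, code_lty Z]"
| "code_prime (TensorAssocInv X Y Z) = list_encode [6, code_lty X, code_lty Y, code_lty Z]"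
| "code_prime (PlusComm X Y) = list_encode [7, code_lty X, code_lty Y]"
| "code_prime (PlusAssoc X Y Z) = list_encode [8, code_lty X, code_lty Y, code_lty Z]"
| "code_prime (PlusAssocInv X Y Z) = list_encode [9, code_lty X, code_lty Y, code_lty Z]"
| "code_prime (TensorFst X Y) = list_encode [10, code_lty X, code_lty Y]"
| "code_prime (TensorSnd X Y) = list_encode [11, code_lty X, code_lty Y]"
| "code_prime (TensorUnit X) = list_encode [12, code_lty X]"
| "code_prime (InLft X Y) = list_encode [13, code_lty X, code_lty Y]"
| "code_prime (InRgt X Y) = list_encode [14, code_lty X, code_lty Y]"
| "code_prime (Codiag X) = list_encode [15, code_lty X]"
| "code_prime (TensorPlusDistr X Y Z) = list_encode [16, code_lty X, code_lty Y, code_lty Z]"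
| "code_prime (Diag X) = list_encode [17, code_lty X]"
| "code_prime (WithFst X Y) = list_encode [18, code_lty X, code_lty Y]"
| "code_prime (WithSnd X Y) = list_encode [19, code_lty X, code_lty Y]"
| "code_prime (TensorWithDistr X Y Z) = list_encode [20, code_lty X, code_lty Y, code_lty Z]"
| "code_prime (WithPlusDistr X Y Z) = list_encode [21, code_lty X, code_lty Y, code_lty Z]"

primrec code_mexp :: "mexp \<Rightarrow> nat" where
  "code_mexp (Prime p) = list_encode [0, code_prime p]"
| "code_mexp (Comp g f) = list_encode [1, code_mexp g, code_mexp f]"
| "code_mexp (PlusMap f g) = list_encode [2, code_mexp f, code_mexp g]"
| "code_mexp (TensorMap f g) = list_encode [3, code_mexp f, code_mexp g]"
| "code_mexp (WithMap f g) = list_encode [4, code_mexp f, code_mexp g]"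

lemma inj_code_tm: "inj code_tm"
proof (rule injI)
  show "t = u" if "code_tm t = code_tm u" for t u
    using that by (cases t; cases u) (auto simp: list_encode_eq simp del: list_encode.simps)
qed

lemma inj_code_fm: "inj code_fm"
proof (rule injI)
  show "\<phi> = \<psi>" if "code_fm \<phi> = code_fm \<psi>" for \<phi> \<psi>
    using that
  proof (induction \<phi> arbitrary: \<psi>)
    case (Rel k r ts)
    then show ?case
      by (cases \<psi>) (auto simp: inj_map_eq_map[OF inj_code_tm] simp: list_encode_eq simp del: list_encode.simps)
  qed (case_tac \<psi>, auto simp: inj_eq[OF inj_code_tm] simp: list_encode_eq simp del: list_encode.simps)+
qed

lemma inj_code_lty: "inj code_lty"
proof (rule injI)
  show "X = Y" if "code_lty X = code_lty Y" for X Y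
    using that
    by (induction X arbitrary: Y) (case_tac Y, auto simp: list_encode_eq simp del: list_encode.simps)+
qed

lemma inj_code_prime: "inj code_prime"
proof (rule injI)
  show "p = q" if "code_prime p = code_prime q" for p q
    using that
    by (cases p; cases q) (auto simp: inj_eq[OF inj_code_lty] simp: list_encode_eq simp del: list_encode.simps)
qed

lemma inj_code_mexp: "inj code_mexp"
proof (rule injI)
  show "e = e'" if "code_mexp e = code_mexp e'" for e e'
    using that
    by (induction e arbitrary: e')
      (case_tac e', auto simp: inj_eq[OF inj_code_prime] simp: list_encode_eq simp del: list_encode.simps)+
qed

end

theory Submission
  imports Defs
begin

text \<open>
  A morphism can be executed symbolically: on an input whose shape is known and whose atoms are
  variables, every prime function other than a test only rearranges the input, and a test on atoms
  leads to a case distinction by an atomic formula. A shape of the domain together with outcomes for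
  the tests thus yields a path condition and a symbolic output. Two morphisms of the same type are
  equal iff, for every shape and all outcomes of the tests in both, the sentence saying that the two
  path conditions imply the equality of the two outputs is true. As both the shapes and the outcomes
  can be coded by boundedly many binary digits, these are finitely many sentences.
\<close>

section \<open>Computable functions on the natural numbers\<close>

text \<open>The obstacle is computability: \<open>recursive\<close> speaks of functions on lists of
  numbers, whereas the procedure traverses syntax trees and threads a state through them. Everything
  is therefore done with unary functions and coded pairs, and recursion over coded trees
  (\<open>srec\<close>) is obtained by a search for a finite piece of its graph. \<open>srec\<close>
  treats the second argument before the first because in \<open>Comp g f\<close> the inner
  \<open>f\<close> stands second and its result is the input of \<open>g\<close>; this is why pairs,
  too, are processed from right to left. The symbolic run never evaluates variables or names, so it
  can be computed without access to the structure, which is consulted only through the truth of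
  sentences. An oracle that predicts a wrong outcome is harmless: its path condition is false.
  Bounded oracles suffice because expressions contain no iteration: a run makes at most one choice
  per prime function, hence no more choices than the code of the expression is large. This is the
  origin of the bounds \<open>2 ^ code_mexp e\<close> and \<open>2 ^ code_lty X\<close>.\<close>

lemma recursive_app1:
  assumes "recursive 1 (\<lambda>xs. F (xs ! 0))" "recursive n f"
  shows "recursive n (\<lambda>xs. F (f xs))"
  using recursive.comp[of "[f]" "\<lambda>xs. F (xs ! 0)" n] assms by simp

lemma recursive_app2:
  assumes "recursive 2 (\<lambda>xs. F (xs ! 0) (xs ! 1))" "recursive n f" "recursive n g"
  shows "recursive n (\<lambda>xs. F (f xs) (g xs))"
  using recursive.comp[of "[f, g]" "\<lambda>xs. F (xs ! 0) (xs ! 1)" n] assms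
  by (auto simp: numeral_2_eq_2)

lemma recursive_Suc:
  assumes "recursive n f"
  shows "recursive n (\<lambda>xs. Suc (f xs))"
proof (rule recursive_app1[OF _ assms])
  show "recursive 1 (\<lambda>xs. Suc (xs ! 0))"
    by (rule recursive.ext[OF recursive.succ]) (auto simp: length_Suc_conv)
qed

lemma recursive_const: "recursive n (\<lambda>xs. c)"
  by (induction c) (auto intro: recursive.zero recursive_Suc)

text \<open>Trades \<open>rec_nat\<close> on lists for a recursion equation with one parameter. A
  function of a single argument is treated by letting \<open>h\<close> ignore its second
  one.\<close>

lemma recursive_rec2:
  assumes "recursive 1 (\<lambda>xs. h 0 (xs ! 0))"
    and "recursive 3 (\<lambda>xs. g (xs ! 0) (xs ! 1) (xs ! 2))"
    and "\<And>k y. h (Suc k) y = g k (h k y) y"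
  shows "recursive 2 (\<lambda>xs. h (xs ! 0) (xs ! 1))"
proof -
  have "recursive 2 (\<lambda>xs. rec_nat ((\<lambda>xs. h 0 (xs ! 0)) (tl xs))
      (\<lambda>k r. (\<lambda>xs. g (xs ! 0) (xs ! 1) (xs ! 2)) (k # r # tl xs)) (hd xs))"
    using recursive.prim_rec[OF assms(1), of "\<lambda>xs. g (xs ! 0) (xs ! 1) (xs ! 2)"] assms(2)
    by (simp add: numeral_3_eq_3 numeral_2_eq_2)
  then show ?thesis
  proof (rule recursive.ext)
    fix xs :: "nat list" assume "length xs = 2"
    then obtain a b where xs: "xs = [a, b]" by (auto simp: length_Suc_conv numeral_2_eq_2)
    have "rec_nat (h 0 b) (\<lambda>k r. g k r b) a = h a b"
      by (induction a) (auto simp: assms(3))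
    then show "rec_nat ((\<lambda>xs. h 0 (xs ! 0)) (tl xs))
        (\<lambda>k r. (\<lambda>xs. g (xs ! 0) (xs ! 1) (xs ! 2)) (k # r # tl xs)) (hd xs) = h (xs ! 0) (xs ! 1)"
      by (simp add: xs)
  qed
qed

lemma recursive_add:
  assumes "recursive n f" "recursive n g"
  shows "recursive n (\<lambda>xs. f xs + g xs)"
  by (rule recursive_app2[OF recursive_rec2[where g = "\<lambda>k r y. Suc r"] assms])
    (auto intro!: recursive_Suc recursive.proj)

lemma recursive_mult:
  assumes "recursive n f" "recursive n g"
  shows "recursive n (\<lambda>xs. f xs * g xs)"
  by (rule recursive_app2[OF recursive_rec2[where g = "\<lambda>k r y. r + y"] assms])
    (auto intro!: recursive_const recursive_add recursive.proj)

text \<open>The predecessor is a recursion that returns its counter, and subtraction iterates it.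
  The recursion runs over the subtrahend, which must come first; hence the order
  \<open>assms(2,1)\<close>.\<close>

lemma recursive_diff:
  assumes "recursive n f" "recursive n g"
  shows "recursive n (\<lambda>xs. f xs - g xs)"
proof -
  have pred: "recursive m (\<lambda>xs. e xs - 1)" if "recursive m e" for m e
    by (rule recursive_app2[OF recursive_rec2[where h = "\<lambda>x y. x - 1" and g = "\<lambda>k r y. k"]
          that that])
      (auto intro!: recursive_const recursive.proj)
  show ?thesis
    by (rule recursive_app2[OF recursive_rec2[where h = "\<lambda>x y. y - x" and g = "\<lambda>k r y. r - 1"]
        assms(2,1)])
      (auto intro!: pred[simplified] recursive.proj)
qed

lemma recursive_triangle:
  assumes "recursive n f"
  shows "recursive n (\<lambda>xs. triangle (f xs))"
  by (rule recursive_app2[OF recursive_rec2[where h = "\<lambda>x y. triangle x"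
        and g = "\<lambda>k r y. r + Suc k"] assms assms])
    (auto intro!: recursive_const recursive_add recursive_Suc recursive.proj)

section \<open>Pairing and computable functions of one argument\<close>

definition pair :: "nat \<Rightarrow> nat \<Rightarrow> nat" where "pair a b = prod_encode (a, b)"
definition pfst :: "nat \<Rightarrow> nat" where "pfst z = fst (prod_decode z)"
definition psnd :: "nat \<Rightarrow> nat" where "psnd z = snd (prod_decode z)"

lemma pair_simps [simp]: "pfst (pair a b) = a" "psnd (pair a b) = b" "pair (pfst z) (psnd z) = z"
  "pair a b = pair c d \<longleftrightarrow> a = c \<and> b = d"
  by (auto simp: pair_def pfst_def psnd_def)

lemma le_pair: "a \<le> pair a b" "b \<le> pair a b"
  by (auto simp: pair_def le_prod_encode_1 le_prod_encode_2)

lemma pfst_le: "pfst z \<le> z" and psnd_le: "psnd z \<le> z"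
  by (metis le_pair(1) pair_simps(3), metis le_pair(2) pair_simps(3))

lemma recursive_pair:
  assumes "recursive n f" "recursive n g"
  shows "recursive n (\<lambda>xs. pair (f xs) (g xs))"
  unfolding pair_def prod_encode_def by (auto intro!: recursive_add recursive_triangle assms)

text \<open>Several arguments are passed as one coded pair. The rules collected in
  \<open>computable_intros\<close> are stated for arbitrary computable subterms, so that
  computability of a composite expression follows by following its syntax.\<close>

definition computable :: "(nat \<Rightarrow> nat) \<Rightarrow> bool" where
  "computable f \<longleftrightarrow> recursive 1 (\<lambda>xs. f (xs ! 0))"

definition computable_pred :: "(nat \<Rightarrow> bool) \<Rightarrow> bool" where
  "computable_pred P \<longleftrightarrow> computable (\<lambda>x. of_bool (P x))"

named_theorems computable_intros

lemma computable_app: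
  assumes "computable F" "computable f"
  shows "computable (\<lambda>x. F (f x))"
  using recursive_app1 assms unfolding computable_def by blast

lemma computable_id [computable_intros]: "computable (\<lambda>x. x)"
  by (simp add: computable_def recursive.proj)

lemma computable_const [computable_intros]: "computable (\<lambda>x. c)"
  by (simp add: computable_def recursive_const)

lemma
  assumes "computable f" "computable g"
  shows computable_add [computable_intros]: "computable (\<lambda>x. f x + g x)"
    and computable_mult [computable_intros]: "computable (\<lambda>x. f x * g x)"
    and computable_diff [computable_intros]: "computable (\<lambda>x. f x - g x)"
    and computable_pair [computable_intros]: "computable (\<lambda>x. pair (f x) (g x))"
  using assms unfolding computable_def
  by (auto intro: recursive_add recursive_mult recursive_diff recursive_pair)

lemma computable_Suc [computable_intros]: "computable f \<Longrightarrow> computable (\<lambda>x. Suc (f x))"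
  unfolding computable_def by (rule recursive_Suc)

lemma computable_triangle: "computable f \<Longrightarrow> computable (\<lambda>x. triangle (f x))"
  unfolding computable_def by (rule recursive_triangle)

lemma computable_predD [computable_intros]:
  "computable_pred P \<Longrightarrow> computable (\<lambda>x. of_bool (P x))"
  by (simp add: computable_pred_def)

lemma computable_pred_less [computable_intros]:
  assumes "computable f" "computable g"
  shows "computable_pred (\<lambda>x. f x < g x)"
proof -
  have "(\<lambda>x. of_bool (f x < g x)) = (\<lambda>x. 1 - (1 - (g x - f x)))" by auto
  then show ?thesis unfolding computable_pred_def
    by (simp only:) (intro computable_intros assms)
qed

lemma computable_pred_not [computable_intros]:
  assumes "computable_pred P"
  shows "computable_pred (\<lambda>x. \<not> P x)"
proof -
  have "(\<lambda>x. of_bool (\<not> P x)) = (\<lambda>x. 1 - of_bool (P x) :: nat)" by auto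
  then show ?thesis unfolding computable_pred_def
    by (simp only:) (intro computable_intros assms)
qed

lemma computable_pred_conj [computable_intros]:
  assumes "computable_pred P" "computable_pred Q"
  shows "computable_pred (\<lambda>x. P x \<and> Q x)"
proof -
  have "(\<lambda>x. of_bool (P x \<and> Q x)) = (\<lambda>x. of_bool (P x) * of_bool (Q x) :: nat)" by auto
  then show ?thesis unfolding computable_pred_def
    by (simp only:) (intro computable_intros assms)
qed

lemma computable_pred_disj [computable_intros]:
  assumes "computable_pred P" "computable_pred Q"
  shows "computable_pred (\<lambda>x. P x \<or> Q x)"
proof -
  have "(\<lambda>x. P x \<or> Q x) = (\<lambda>x. \<not> (\<not> P x \<and> \<not> Q x))" by auto
  then show ?thesis by (simp only:) (intro computable_intros assms)
qed

lemma computable_pred_imp [computable_intros]: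
  assumes "computable_pred P" "computable_pred Q"
  shows "computable_pred (\<lambda>x. P x \<longrightarrow> Q x)"
proof -
  have "(\<lambda>x. P x \<longrightarrow> Q x) = (\<lambda>x. \<not> P x \<or> Q x)" by auto
  then show ?thesis by (simp only:) (intro computable_intros assms)
qed

lemma computable_pred_le [computable_intros]:
  assumes "computable f" "computable g"
  shows "computable_pred (\<lambda>x. f x \<le> g x)"
  unfolding not_less[symmetric] by (intro computable_intros assms)

lemma computable_pred_eq [computable_intros]:
  assumes "computable f" "computable g"
  shows "computable_pred (\<lambda>x. f x = g x)"
  unfolding eq_iff by (intro computable_intros assms)

lemma computable_if [computable_intros]:
  assumes "computable_pred P" "computable f" "computable g"
  shows "computable (\<lambda>x. if P x then f x else g x)"
proof -
  have "(\<lambda>x. if P x then f x else g x) = (\<lambda>x. of_bool (P x) * f x + (1 - of_bool (P x)) * g x)"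
    by auto
  then show ?thesis by (simp only:) (intro computable_intros assms)
qed

text \<open>The predicate is given in curried form because unpairing is itself defined by minimisation.\<close>

lemma recursive_Least:
  assumes "recursive 2 (\<lambda>xs. of_bool (P (xs ! 1) (xs ! 0)))" "\<And>x. \<exists>y. P x y"
  shows "computable (\<lambda>x. LEAST y. P x y)"
proof -
  \<comment> \<open>Minimisation looks for a zero, so the truth value is inverted. The sought number
    is the head of the argument list, which is why it sits at index 0.\<close>
  have "recursive 2 (\<lambda>xs. 1 - of_bool (P (xs ! 1) (xs ! 0)))"
    by (rule recursive_diff[OF recursive_const assms(1)])
  then have "recursive (1 + 1) (\<lambda>xs. 1 - of_bool (P (xs ! 1) (xs ! 0)))"
    by (simp add: numeral_2_eq_2)
  then have "recursive 1 (\<lambda>xs. LEAST y. 1 - of_bool (P ((y # xs) ! 1) ((y # xs) ! 0)) = (0 :: nat))"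
    by (rule recursive.minimisation) (use assms(2) in \<open>auto simp: of_bool_def\<close>)
  then show ?thesis unfolding computable_def
    by (rule back_subst[of "recursive 1"]) (auto simp: of_bool_def intro!: ext arg_cong[of _ _ Least])
qed

text \<open>Since \<open>pair a b = triangle (a + b) + a\<close>, the number \<open>z\<close> lies
  on the diagonal \<open>w = a + b\<close> with
  \<open>triangle w \<le> z < triangle (Suc w)\<close>. The least \<open>w\<close> satisfying the
  second inequality is this diagonal, and \<open>a\<close> is the offset of \<open>z\<close> on
  it.\<close>

lemma prod_decode_Least:
  "pfst z = z - triangle (LEAST w. z < triangle (Suc w))"
  "psnd z = (LEAST w. z < triangle (Suc w)) - pfst z"
proof -
  have z: "z = triangle (pfst z + psnd z) + pfst z"
    using pair_simps(3)[of z] by (simp add: pair_def prod_encode_def)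
  have mono: "triangle a \<le> triangle b" if "a \<le> b" for a b
    using that by (induction rule: dec_induct) auto
  have "(LEAST w. z < triangle (Suc w)) = pfst z + psnd z"
  proof (rule Least_equality)
    show "z < triangle (Suc (pfst z + psnd z))" by (subst z) simp
    show "pfst z + psnd z \<le> y" if "z < triangle (Suc y)" for y
    proof (rule ccontr)
      assume "\<not> pfst z + psnd z \<le> y"
      then have "triangle (Suc y) \<le> triangle (pfst z + psnd z)" by (intro mono) simp
      with that z show False by linarith
    qed
  qed
  then show "pfst z = z - triangle (LEAST w. z < triangle (Suc w))"
    "psnd z = (LEAST w. z < triangle (Suc w)) - pfst z"
    using z by (simp_all del: triangle_Suc)
qed

lemma
  shows computable_pfst0: "computable pfst" and computable_psnd0: "computable psnd"
proof -
  have "recursive 2 (\<lambda>xs. of_bool (xs ! 1 < triangle (Suc (xs ! 0))))"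
  proof -
    have "(\<lambda>xs. of_bool (xs ! 1 < triangle (Suc (xs ! 0)))) =
        (\<lambda>xs. 1 - (1 - (triangle (Suc (xs ! 0)) - xs ! 1)))"
      by (auto simp del: triangle_Suc)
    then show ?thesis
      by (simp only:) (intro recursive_diff recursive_const recursive_triangle recursive_Suc recursive.proj, auto)
  qed
  then have w: "computable (\<lambda>z. LEAST w. z < triangle (Suc w))"
  proof (rule recursive_Least)
    have "n \<le> triangle n" for n by (induction n) auto
    then show "\<exists>w. z < triangle (Suc w)" for z by (meson Suc_le_lessD)
  qed
  have "computable (\<lambda>z. z - triangle (LEAST w. z < triangle (Suc w)))"
    by (intro computable_intros computable_triangle w)
  then show f: "computable pfst" unfolding prod_decode_Least(1)[symmetric] .
  have "computable (\<lambda>z. (LEAST w. z < triangle (Suc w)) - pfst z)"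
    by (intro computable_intros w f)
  then show "computable psnd" unfolding prod_decode_Least(2)[symmetric] .
qed

lemmas computable_pfst [computable_intros] = computable_app[OF computable_pfst0]
lemmas computable_psnd [computable_intros] = computable_app[OF computable_psnd0]

lemma computable_Least:
  assumes "computable_pred (\<lambda>z. P (pfst z) (psnd z))" "\<And>x. \<exists>y. P x y"
  shows "computable (\<lambda>x. LEAST y. P x y)"
proof (rule recursive_Least[OF _ assms(2)])
  have "recursive 2 (\<lambda>xs. of_bool (P (pfst (pair (xs ! 1) (xs ! 0))) (psnd (pair (xs ! 1) (xs ! 0)))))"
    by (rule recursive_app1[where F = "\<lambda>z. of_bool (P (pfst z) (psnd z))"])
      (use assms(1) in \<open>auto simp: computable_def computable_pred_def intro!: recursive_pair recursive.proj\<close>)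
  then show "recursive 2 (\<lambda>xs. of_bool (P (xs ! 1) (xs ! 0)))" by simp
qed

text \<open>The bound is offered as an alternative solution, which makes the search total. A witness
  exists iff the search stops strictly below the bound.\<close>

lemma computable_pred_bex [computable_intros]:
  assumes "computable_pred (\<lambda>z. P (pfst z) (psnd z))" "computable f"
  shows "computable_pred (\<lambda>x. \<exists>y<f x. P x y)"
proof -
  have "(\<exists>y<f x. P x y) \<longleftrightarrow> (LEAST y. P x y \<or> f x \<le> y) < f x" for x
  proof
    assume "\<exists>y<f x. P x y"
    then show "(LEAST y. P x y \<or> f x \<le> y) < f x"
      by (metis (mono_tags, lifting) Least_le le_less_trans)
  next
    assume "(LEAST y. P x y \<or> f x \<le> y) < f x"
    moreover have "P x (LEAST y. P x y \<or> f x \<le> y) \<or> f x \<le> (LEAST y. P x y \<or> f x \<le> y)"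
      by (rule LeastI[of _ "f x"]) simp
    ultimately show "\<exists>y<f x. P x y" by auto
  qed
  moreover have "computable (\<lambda>x. LEAST y. P x y \<or> f x \<le> y)"
    by (rule computable_Least) (auto intro!: computable_intros assms intro: computable_app[OF assms(2)])
  ultimately show ?thesis
    by (simp only:) (intro computable_intros assms)
qed

lemma computable_pred_ball [computable_intros]:
  assumes "computable_pred (\<lambda>z. P (pfst z) (psnd z))" "computable f"
  shows "computable_pred (\<lambda>x. \<forall>y<f x. P x y)"
proof -
  have "(\<lambda>x. \<forall>y<f x. P x y) = (\<lambda>x. \<not> (\<exists>y<f x. \<not> P x y))" by auto
  then show ?thesis by (simp only:) (intro computable_intros assms)
qed

lemma computable_rec_nat [computable_intros]:
  assumes "computable (\<lambda>z. g (pfst z) (pfst (psnd z)) (psnd (psnd z)))"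
    and "computable f" "computable m"
  shows "computable (\<lambda>x. rec_nat (f x) (g x) (m x))"
proof -
  define h where "h = (\<lambda>k x. rec_nat (f x) (g x) k)"
  have "recursive 2 (\<lambda>xs. h (xs ! 0) (xs ! 1))"
  proof (rule recursive_rec2[where g = "\<lambda>k r x. g x k r"])
    show "recursive 1 (\<lambda>xs. h 0 (xs ! 0))" using assms(2) by (simp add: h_def computable_def)
    show "recursive 3 (\<lambda>xs. g (xs ! 2) (xs ! 0) (xs ! 1))"
      using recursive_app1[OF assms(1)[unfolded computable_def], of 3
          "\<lambda>xs. pair (xs ! 2) (pair (xs ! 0) (xs ! 1))"]
      by (simp add: recursive_pair recursive.proj)
    show "h (Suc k) x = g x k (h k x)" for k x by (simp add: h_def)
  qed
  then have "recursive 1 (\<lambda>xs. h (m (xs ! 0)) (xs ! 0))"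
    by (rule recursive_app2) (use assms(3) computable_id in \<open>auto simp: computable_def\<close>)
  then show ?thesis by (simp add: h_def computable_def)
qed

lemma computable_power [computable_intros]:
  assumes "computable f" "computable g"
  shows "computable (\<lambda>x. f x ^ g x)"
proof -
  have "f x ^ g x = rec_nat 1 (\<lambda>k r. f x * r) (g x)" for x
  proof -
    have "f x ^ n = rec_nat 1 (\<lambda>k r. f x * r) n" for n by (induction n) auto
    then show ?thesis .
  qed
  then show ?thesis
    by (simp only:) (intro computable_intros assms computable_app[OF assms(1)])
qed

text \<open>The quotient is the least \<open>q\<close> with \<open>a < b * Suc q\<close>. Division
  by zero is split off, and the disjunct \<open>b = 0\<close> keeps the search total in that
  case.\<close>

lemma computable_div [computable_intros]:
  assumes "computable f" "computable g"
  shows "computable (\<lambda>x. f x div g x)"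
proof -
  have *: "a div b = (if b = 0 then 0 else LEAST q. b = 0 \<or> a < b * Suc q)" for a b :: nat
  proof (cases "b = 0")
    case False
    have "(LEAST q. a < b * Suc q) = a div b"
    proof (rule Least_equality)
      show "a < b * Suc (a div b)" using False by (simp add: dividend_less_times_div)
      show "a div b \<le> q" if "a < b * Suc q" for q
        using that False by (metis less_Suc_eq_le less_mult_imp_div_less mult.commute)
    qed
    then show ?thesis using False by simp
  qed simp
  have "computable (\<lambda>x. LEAST q. g x = 0 \<or> f x < g x * Suc q)"
  proof (rule computable_Least)
    show "\<exists>q. g x = 0 \<or> f x < g x * Suc q" for x
      by (metis div_less_iff_less_mult lessI less_mult_imp_div_less mult.commute neq0_conv)
  qed (intro computable_intros computable_app[OF assms(1)] computable_app[OF assms(2)])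
  then show ?thesis unfolding *
    by (intro computable_intros assms)
qed

lemma computable_pred_odd [computable_intros]:
  assumes "computable f"
  shows "computable_pred (\<lambda>x. odd (f x))"
proof -
  have "odd n \<longleftrightarrow> n = 2 * (n div 2) + 1" for n :: nat by presburger
  then show ?thesis by (simp only:) (intro computable_intros assms)
qed

text \<open>A number represents the finite set of positions of its binary ones. In this way a search
  over numbers becomes a search over finite sets, as needed for graphs of recursive
  functions.\<close>

lemma computable_pred_set_decode [computable_intros]:
  assumes "computable f" "computable g"
  shows "computable_pred (\<lambda>x. f x \<in> set_decode (g x))"
  unfolding set_decode_def mem_Collect_eq by (intro computable_intros assms)

section \<open>Recursion on coded terms\<close>

text \<open>Every number codes a list, hence a term: the first entry is its tag, the others its arguments.\<close>

definition lcons :: "nat \<Rightarrow> nat \<Rightarrow> nat" where "lcons a b = Suc (pair a b)"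
definition lhd :: "nat \<Rightarrow> nat" where "lhd x = pfst (x - 1)"
definition ltl :: "nat \<Rightarrow> nat" where "ltl x = psnd (x - 1)"

lemma lcons_simps [simp]: "lhd (lcons a b) = a" "ltl (lcons a b) = b" "lcons a b \<noteq> 0" "lcons a b > 0"
  "lcons a b = lcons c d \<longleftrightarrow> a = c \<and> b = d"
  by (auto simp: lcons_def lhd_def ltl_def)

lemma list_encode_lcons: "list_encode [] = 0" "list_encode (x # xs) = lcons x (list_encode xs)"
  by (simp_all add: lcons_def pair_def)

text \<open>The value \<open>pair a b\<close> is at least \<open>triangle (a + b)\<close>. Bounding
  the sum, and not only each part, is what later lets codes bound the total number of oracle digits
  read in both parts of a term.\<close>

lemma add_less_lcons: "a + b < lcons a b"
proof -
  have "n \<le> triangle n" for n by (induction n) auto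
  from this[of "a + b"] show ?thesis by (simp add: lcons_def pair_def prod_encode_def)
qed

lemma ltl_less: "x > 0 \<Longrightarrow> ltl x < x"
  by (auto simp: ltl_def intro: le_less_trans[OF psnd_le])

definition arg1 :: "nat \<Rightarrow> nat" where "arg1 x = lhd (ltl x)"
definition arg2 :: "nat \<Rightarrow> nat" where "arg2 x = lhd (ltl (ltl x))"
definition arg3 :: "nat \<Rightarrow> nat" where "arg3 x = lhd (ltl (ltl (ltl x)))"

lemma args_lcons [simp]:
  "arg1 (lcons t (lcons a u)) = a"
  "arg2 (lcons t (lcons a (lcons b v))) = b"
  "arg3 (lcons t (lcons a (lcons b (lcons c w)))) = c"
  by (simp_all add: arg1_def arg2_def arg3_def)

lemma arg_less: assumes "x > 0" shows "arg1 x < x" "arg2 x < x"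
proof -
  have le: "lhd y \<le> y" "ltl y \<le> y" for y
    unfolding lhd_def ltl_def by (meson diff_le_self order_trans pfst_le psnd_le)+
  show "arg1 x < x" "arg2 x < x"
    unfolding arg1_def arg2_def
    by (meson le ltl_less[OF assms] le_less_trans order_trans)+
qed

lemma
  assumes "computable f"
  shows computable_lhd [computable_intros]: "computable (\<lambda>x. lhd (f x))"
    and computable_ltl [computable_intros]: "computable (\<lambda>x. ltl (f x))"
  unfolding lhd_def ltl_def by (intro computable_intros assms)+

lemma
  assumes "computable f"
  shows computable_arg1 [computable_intros]: "computable (\<lambda>x. arg1 (f x))"
    and computable_arg2 [computable_intros]: "computable (\<lambda>x. arg2 (f x))"
    and computable_arg3 [computable_intros]: "computable (\<lambda>x. arg3 (f x))"
  unfolding arg1_def arg2_def arg3_def by (intro computable_intros assms)+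

lemma computable_lcons [computable_intros]:
  assumes "computable f" "computable g"
  shows "computable (\<lambda>x. lcons (f x) (g x))"
  unfolding lcons_def by (intro computable_intros assms)

text \<open>
  The parameter of the recursive call on the first argument may depend on the result of the call
  on the second one. This threads a state through a traversal of the term.
\<close>

function srec :: "(nat \<Rightarrow> nat \<Rightarrow> nat) \<Rightarrow> (nat \<Rightarrow> nat \<Rightarrow> nat \<Rightarrow> nat) \<Rightarrow>
    (nat \<Rightarrow> nat \<Rightarrow> nat \<Rightarrow> nat \<Rightarrow> nat) \<Rightarrow> nat \<Rightarrow> nat \<Rightarrow> nat" where
  "srec Q Q' G p x =
    (if x = 0 then 0
     else let r = srec Q Q' G (Q p x) (arg2 x); r' = srec Q Q' G (Q' p x r) (arg1 x)
       in G p x r r')"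
  by pat_completeness auto
termination
  by (relation "measure (\<lambda>(Q, Q', G, p, x). x)") (auto simp: arg_less)

declare srec.simps [simp del]

lemma srec_pos:
  "x > 0 \<Longrightarrow> srec Q Q' G p x =
    (let r = srec Q Q' G (Q p x) (arg2 x); r' = srec Q Q' G (Q' p x r) (arg1 x) in G p x r r')"
  by (subst srec.simps) simp

text \<open>A closed set of triples \<open>((p, x), y)\<close> is a part of the graph of \<open>srec\<close>.\<close>

definition srec_closed :: "(nat \<Rightarrow> nat \<Rightarrow> nat) \<Rightarrow> (nat \<Rightarrow> nat \<Rightarrow> nat \<Rightarrow> nat) \<Rightarrow>
    (nat \<Rightarrow> nat \<Rightarrow> nat \<Rightarrow> nat \<Rightarrow> nat) \<Rightarrow> nat set \<Rightarrow> bool" where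
  "srec_closed Q Q' G C \<longleftrightarrow> (\<forall>p x y. pair (pair p x) y \<in> C \<longrightarrow>
     (if x = 0 then y = 0
      else \<exists>r r'. pair (pair (Q p x) (arg2 x)) r \<in> C \<and> pair (pair (Q' p x r) (arg1 x)) r' \<in> C \<and>
        y = G p x r r'))"

lemma srec_closed_sound:
  assumes "srec_closed Q Q' G C" "pair (pair p x) y \<in> C"
  shows "y = srec Q Q' G p x"
  using assms(2)
proof (induction x arbitrary: p y rule: less_induct)
  case (less x)
  show ?case
  proof (cases "x = 0")
    case True
    then show ?thesis using assms(1) less.prems by (auto simp: srec_closed_def srec.simps)
  next
    case False
    then obtain r r' where "pair (pair (Q p x) (arg2 x)) r \<in> C"
      "pair (pair (Q' p x r) (arg1 x)) r' \<in> C" "y = G p x r r'"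
      using assms(1) less.prems unfolding srec_closed_def by metis
    with less.IH arg_less[of x] False show ?thesis
      by (auto simp: srec_pos)
  qed
qed

lemma srec_closed_Un:
  "srec_closed Q Q' G C \<Longrightarrow> srec_closed Q Q' G D \<Longrightarrow> srec_closed Q Q' G (C \<union> D)"
  unfolding srec_closed_def by (smt (verit) Un_iff)

lemma srec_closed_insert:
  assumes "srec_closed Q Q' G C" "x > 0"
    and "pair (pair (Q p x) (arg2 x)) r \<in> C" "pair (pair (Q' p x r) (arg1 x)) r' \<in> C"
  shows "srec_closed Q Q' G (insert (pair (pair p x) (G p x r r')) C)"
  using assms unfolding srec_closed_def
  by (smt (verit) insert_iff pair_simps(4) less_irrefl)

text \<open>The arguments and results of all calls made during one evaluation form such a set: take
  the sets of the two recursive calls and add the triple of the call itself.\<close>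

lemma srec_closed_exists:
  "\<exists>C. finite C \<and> srec_closed Q Q' G C \<and> pair (pair p x) (srec Q Q' G p x) \<in> C"
proof (induction x arbitrary: p rule: less_induct)
  case (less x)
  show ?case
  proof (cases "x = 0")
    case True
    then show ?thesis
      by (intro exI[of _ "{pair (pair p 0) 0}"]) (auto simp: srec_closed_def srec.simps)
  next
    case False
    define r where "r = srec Q Q' G (Q p x) (arg2 x)"
    define r' where "r' = srec Q Q' G (Q' p x r) (arg1 x)"
    obtain C where C: "finite C" "srec_closed Q Q' G C" "pair (pair (Q p x) (arg2 x)) r \<in> C"
      using less.IH[of "arg2 x"] arg_less False unfolding r_def by blast
    obtain D where D: "finite D" "srec_closed Q Q' G D" "pair (pair (Q' p x r) (arg1 x)) r' \<in> D"
      using less.IH[of "arg1 x"] arg_less False unfolding r'_def by blast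
    have "srec Q Q' G p x = G p x r r'"
      using False by (simp add: srec_pos r_def r'_def Let_def)
    moreover have "srec_closed Q Q' G (insert (pair (pair p x) (G p x r r')) (C \<union> D))"
      using C D False by (intro srec_closed_insert srec_closed_Un) auto
    ultimately show ?thesis using C D
      by (intro exI[of _ "insert (pair (pair p x) (G p x r r')) (C \<union> D)"]) auto
  qed
qed

lemma set_decode_less: "e \<in> set_decode c \<Longrightarrow> e < c"
proof -
  assume "e \<in> set_decode c"
  then have "c div 2 ^ e \<noteq> 0" unfolding set_decode_def by (metis mem_Collect_eq even_zero)
  then have "2 ^ e \<le> c" by (metis div_less not_le)
  then show ?thesis by (meson less_exp order_less_le_trans)
qed

text \<open>Every element of \<open>set_decode c\<close> is below \<open>c\<close>, and a component
  of a pair does not exceed the pair. All quantifiers can thus be bounded by \<open>c\<close>, which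
  brings closedness into the reach of \<open>computable_intros\<close>.\<close>

lemma srec_closed_set_decode:
  "srec_closed Q Q' G (set_decode c) \<longleftrightarrow>
    (\<forall>e<c. e \<in> set_decode c \<longrightarrow>
       (psnd (pfst e) = 0 \<and> psnd e = 0) \<or>
       (0 < psnd (pfst e) \<and> (\<exists>r<c. \<exists>r'<c.
          pair (pair (Q (pfst (pfst e)) (psnd (pfst e))) (arg2 (psnd (pfst e)))) r \<in> set_decode c \<and>
          pair (pair (Q' (pfst (pfst e)) (psnd (pfst e)) r) (arg1 (psnd (pfst e)))) r' \<in> set_decode c \<and>
          psnd e = G (pfst (pfst e)) (psnd (pfst e)) r r')))"
  (is "?L \<longleftrightarrow> ?R")
proof
  have bound: "r < c" if "pair z r \<in> set_decode c" for z r
    using set_decode_less[OF that] le_pair(2) le_less_trans by blast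
  show ?R if L: ?L
  proof (intro allI impI)
    fix e assume "e < c" "e \<in> set_decode c"
    then have "pair (pair (pfst (pfst e)) (psnd (pfst e))) (psnd e) \<in> set_decode c" by simp
    then show "(psnd (pfst e) = 0 \<and> psnd e = 0) \<or>
       (0 < psnd (pfst e) \<and> (\<exists>r<c. \<exists>r'<c.
          pair (pair (Q (pfst (pfst e)) (psnd (pfst e))) (arg2 (psnd (pfst e)))) r \<in> set_decode c \<and>
          pair (pair (Q' (pfst (pfst e)) (psnd (pfst e)) r) (arg1 (psnd (pfst e)))) r' \<in> set_decode c \<and>
          psnd e = G (pfst (pfst e)) (psnd (pfst e)) r r'))"
      using L bound unfolding srec_closed_def by (metis gr0I)
  qed
  show ?L if R: ?R
    unfolding srec_closed_def
  proof (intro allI impI)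
    fix p x y assume "pair (pair p x) y \<in> set_decode c"
    with R set_decode_less[OF this] show "if x = 0 then y = 0 else \<exists>r r'.
        pair (pair (Q p x) (arg2 x)) r \<in> set_decode c \<and>
        pair (pair (Q' p x r) (arg1 x)) r' \<in> set_decode c \<and> y = G p x r r'"
      by fastforce
  qed
qed

text \<open>Search for a number \<open>m\<close> that pairs a candidate value with the code of a
  closed set containing the corresponding triple. Such an \<open>m\<close> exists by
  \<open>srec_closed_exists\<close>, and by \<open>srec_closed_sound\<close> the value in any such
  \<open>m\<close> is correct, in particular that in the least one.\<close>

lemma computable_srec:
  assumes Q: "computable (\<lambda>z. Q (pfst z) (psnd z))"
    and Q': "computable (\<lambda>z. Q' (pfst z) (pfst (psnd z)) (psnd (psnd z)))"
    and G: "computable (\<lambda>z. G (pfst z) (pfst (psnd z)) (pfst (psnd (psnd z))) (psnd (psnd (psnd z))))"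
    and f: "computable f" and g: "computable g"
  shows "computable (\<lambda>x. srec Q Q' G (f x) (g x))"
proof -
  have intros:
    "\<lbrakk>computable a; computable b\<rbrakk> \<Longrightarrow> computable (\<lambda>x. Q (a x) (b x))"
    "\<lbrakk>computable a; computable b; computable c\<rbrakk> \<Longrightarrow> computable (\<lambda>x. Q' (a x) (b x) (c x))"
    "\<lbrakk>computable a; computable b; computable c; computable d\<rbrakk> \<Longrightarrow>
      computable (\<lambda>x. G (a x) (b x) (c x) (d x))" for a b c d
    using computable_app[OF Q, of "\<lambda>x. pair (a x) (b x)"]
      computable_app[OF Q', of "\<lambda>x. pair (a x) (pair (b x) (c x))"]
      computable_app[OF G, of "\<lambda>x. pair (a x) (pair (b x) (pair (c x) (d x)))"]
    by (simp_all add: computable_pair)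
  define found where "found z m \<longleftrightarrow>
    pair z (pfst m) \<in> set_decode (psnd m) \<and> srec_closed Q Q' G (set_decode (psnd m))" for z m
  have ex: "\<exists>m. found z m" for z
  proof -
    obtain C where "finite C" "srec_closed Q Q' G C" "pair z (srec Q Q' G (pfst z) (psnd z)) \<in> C"
      using srec_closed_exists[of Q Q' G "pfst z" "psnd z"] by auto
    then have "found z (pair (srec Q Q' G (pfst z) (psnd z)) (set_encode C))"
      by (simp add: found_def)
    then show ?thesis by blast
  qed
  have "pfst m = srec Q Q' G (pfst z) (psnd z)" if "found z m" for z m
    using that srec_closed_sound[of Q Q' G _ "pfst z" "psnd z"] unfolding found_def by auto
  from this[OF LeastI_ex[OF ex]]
  have eq: "pfst (LEAST m. found (pair (f x) (g x)) m) = srec Q Q' G (f x) (g x)" for x by simp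
  have "computable (\<lambda>z. LEAST m. found z m)"
    by (rule computable_Least[OF _ ex], unfold found_def srec_closed_set_decode)
      (intro computable_intros intros)
  from computable_pfst[OF computable_app[OF this computable_pair[OF f g]]]
  show ?thesis by (simp only: eq)
qed

section \<open>Symbolic execution\<close>

text \<open>
  A symbolic value is a value whose atoms are terms. Numbers serve as oracles: their binary digits
  are consumed from the least significant one, one for every choice. Pairs are processed from right
  to left.
\<close>

primrec sym_val :: "lty \<Rightarrow> nat \<times> nat \<Rightarrow> tm val \<times> nat \<times> nat" where
  "sym_val One = (\<lambda>s. (Unit, s))"
| "sym_val Atoms = (\<lambda>(b, n). (Atom (Var n), b, Suc n))"
| "sym_val (X \<oplus> Y) = (\<lambda>(b, n).
     if odd b then apfst Lft (sym_val X (b div 2, n)) else apfst Rgt (sym_val Y (b div 2, n)))"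
| "sym_val (X \<sqinter> Y) = (\<lambda>s. case sym_val Y s of (y, s') \<Rightarrow> apfst (\<lambda>x. Tup x y) (sym_val X s'))"
| "sym_val (X \<otimes> Y) = (\<lambda>s. case sym_val Y s of (y, s') \<Rightarrow> apfst (\<lambda>x. Tup x y) (sym_val X s'))"

text \<open>\<open>fm\<close> has no constant for truth. This formula is closed, uses no symbol of
  the structure, and is true in the empty structure as well.\<close>

definition true_fm :: fm where "true_fm = Forall 0 (Eq (Var 0) (Var 0))"

text \<open>
  The state of an execution consists of the oracle and the path condition: the conjunction of the
  outcomes of the tests, as chosen by the oracle.
\<close>

definition branch :: "fm \<Rightarrow> nat \<times> fm \<Rightarrow> tm val \<times> nat \<times> fm" where
  "branch \<theta> = (\<lambda>(b, \<phi>). (truth_val (odd b), b div 2, Conj \<phi> (if odd b then \<theta> else Neg \<theta>)))"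

text \<open>All prime functions except the tests are uniform in the atoms, so their semantics
  \<open>prime_fun\<close> is reused with terms in the place of atoms. The tests are intercepted
  because syntactic identity of terms says nothing final about their values.\<close>

definition run_prime ::
    "tm rel_structure \<Rightarrow> tm naming \<Rightarrow> prime \<Rightarrow> tm val \<times> nat \<times> fm \<Rightarrow> tm val \<times> nat \<times> fm" where
  "run_prime A \<kappa> p = (\<lambda>(v, s). case p of
     EqTest \<Rightarrow> branch (Eq (components v ! 0) (components v ! 1)) s
   | RelTest k r \<Rightarrow> branch (Rel k r (components v)) s
   | _ \<Rightarrow> (prime_fun A \<kappa> p v, s))"

primrec run ::
    "tm rel_structure \<Rightarrow> tm naming \<Rightarrow> mexp \<Rightarrow> tm val \<times> nat \<times> fm \<Rightarrow> tm val \<times> nat \<times> fm" where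
  "run A \<kappa> (Prime p) = run_prime A \<kappa> p"
| "run A \<kappa> (Comp g f) = run A \<kappa> g \<circ> run A \<kappa> f"
| "run A \<kappa> (PlusMap f g) = (\<lambda>(v, s). case v of
     Lft x \<Rightarrow> apfst Lft (run A \<kappa> f (x, s)) | Rgt y \<Rightarrow> apfst Rgt (run A \<kappa> g (y, s)))"
| "run A \<kappa> (TensorMap f g) = (\<lambda>(v, s). case v of
     Tup x y \<Rightarrow> case run A \<kappa> g (y, s) of (y', s') \<Rightarrow> apfst (\<lambda>x'. Tup x' y') (run A \<kappa> f (x, s')))"
| "run A \<kappa> (WithMap f g) = (\<lambda>(v, s). case v of
     Tup x y \<Rightarrow> case run A \<kappa> g (y, s) of (y', s') \<Rightarrow> apfst (\<lambda>x'. Tup x' y') (run A \<kappa> f (x, s')))"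

primrec eq_fm :: "tm val \<Rightarrow> tm val \<Rightarrow> fm" where
  "eq_fm Unit = (\<lambda>w. case w of Unit \<Rightarrow> true_fm | _ \<Rightarrow> Neg true_fm)"
| "eq_fm (Atom t) = (\<lambda>w. case w of Atom u \<Rightarrow> Eq t u | _ \<Rightarrow> Neg true_fm)"
| "eq_fm (Lft x) = (\<lambda>w. case w of Lft y \<Rightarrow> eq_fm x y | _ \<Rightarrow> Neg true_fm)"
| "eq_fm (Rgt x) = (\<lambda>w. case w of Rgt y \<Rightarrow> eq_fm x y | _ \<Rightarrow> Neg true_fm)"
| "eq_fm (Tup x x') = (\<lambda>w. case w of Tup y y' \<Rightarrow> Conj (eq_fm x y) (eq_fm x' y') | _ \<Rightarrow> Neg true_fm)"

primrec forall_upto :: "nat \<Rightarrow> fm \<Rightarrow> fm" where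
  "forall_upto 0 \<phi> = \<phi>"
| "forall_upto (Suc n) \<phi> = Forall n (forall_upto n \<phi>)"

definition tms :: "'a naming \<Rightarrow> nat \<Rightarrow> tm set" where
  "tms \<nu> n = {t. wf_tm \<nu> t \<and> tm_vars t \<subseteq> {..<n}}"

text \<open>Makes terms the atoms of a structure, so that \<open>elems\<close> over it types the
  symbolic values and lemmas such as \<open>prime_fun_elems\<close> and
  \<open>components_atoms_pow\<close> apply to them. The relation symbols of \<open>M\<close> are
  kept in order that the same expressions are well-formed.\<close>

definition tm_structure :: "'a rel_structure \<Rightarrow> 'a naming \<Rightarrow> nat \<Rightarrow> tm rel_structure" where
  "tm_structure M \<nu> n = \<lparr>universe = tms \<nu> n, rels = rels M, rel = (\<lambda>_ _. {})\<rparr>"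

definition cst_naming :: "'a naming \<Rightarrow> tm naming" where
  "cst_naming \<nu> c = map_option (\<lambda>_. Cst c) (\<nu> c)"

definition agree_fm :: "'a rel_structure \<Rightarrow> 'a naming \<Rightarrow> mexp \<Rightarrow> mexp \<Rightarrow> nat \<Rightarrow> nat \<Rightarrow> nat \<Rightarrow> fm" where
  "agree_fm M \<nu> e1 e2 b b1 b2 =
     (case sym_val (mdom e1) (b, 0) of (v, _, n) \<Rightarrow>
      case run (tm_structure M \<nu> n) (cst_naming \<nu>) e1 (v, b1, true_fm) of (v1, _, \<phi>1) \<Rightarrow>
      case run (tm_structure M \<nu> n) (cst_naming \<nu>) e2 (v, b2, true_fm) of (v2, _, \<phi>2) \<Rightarrow>
        forall_upto n (Imp (Conj \<phi>1 \<phi>2) (eq_fm v1 v2)))"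

section \<open>Typing and evaluation of symbolic values and formulas\<close>

lemma true_fm_simps [simp]: "sat M \<nu> s true_fm" "wf_fm M \<nu> true_fm" "free_vars true_fm = {}"
  by (simp_all add: true_fm_def)

lemma sat_eq_fm [simp]:
  "sat M \<nu> s (eq_fm v w) \<longleftrightarrow> map_val (tm_val \<nu> s) v = map_val (tm_val \<nu> s) w"
  by (induction v arbitrary: w) (auto split: val.split)

lemma universe_tm_structure [simp]: "universe (tm_structure M \<nu> n) = tms \<nu> n"
  and rels_tm_structure [simp]: "rels (tm_structure M \<nu> n) = rels M"
  by (simp_all add: tm_structure_def)

lemma dom_cst_naming [simp]: "dom (cst_naming \<nu>) = dom \<nu>"
  by (auto simp: cst_naming_def dom_def)

lemma ran_cst_naming: "ran (cst_naming \<nu>) \<subseteq> tms \<nu> n"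
  by (auto simp: cst_naming_def ran_def tms_def)

lemma wf_prime_tm_structure [simp]:
  "wf_prime (tm_structure M \<nu> n) (cst_naming \<nu>) p = wf_prime M \<nu> p"
  by (cases p) auto

lemma wf_mexp_tm_structure [simp]:
  "wf_mexp (tm_structure M \<nu> n) (cst_naming \<nu>) e = wf_mexp M \<nu> e"
  by (induction e) auto

lemma tms_mono: "n \<le> n' \<Longrightarrow> tms \<nu> n \<subseteq> tms \<nu> n'"
  by (auto simp: tms_def)

lemma elems_mono: "universe A \<subseteq> universe B \<Longrightarrow> elems A X \<subseteq> elems B X"
  by (induction X) auto

lemma map_val_elems:
  "v \<in> elems A X \<Longrightarrow> f ` universe A \<subseteq> universe B \<Longrightarrow> map_val f v \<in> elems B X"
  by (induction X arbitrary: v) auto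

lemma components_map_val: "components (map_val f v) = map f (components v)"
  by (induction v) auto

lemma set_val_elems: "v \<in> elems A X \<Longrightarrow> set_val v \<subseteq> universe A"
  by (induction X arbitrary: v) fastforce+

lemma map_val_cong_elems:
  "v \<in> elems A X \<Longrightarrow> (\<And>a. a \<in> universe A \<Longrightarrow> f a = g a) \<Longrightarrow> map_val f v = map_val g v"
  using set_val_elems by (intro val.map_cong0) blast

lemma tm_val_cong: "t \<in> tms \<nu> n \<Longrightarrow> (\<And>i. i < n \<Longrightarrow> s i = s' i) \<Longrightarrow> tm_val \<nu> s t = tm_val \<nu> s' t"
  by (cases t) (auto simp: tms_def)

lemma tm_val_universe:
  assumes "ran \<nu> \<subseteq> universe M" "\<And>i. i < n \<Longrightarrow> s i \<in> universe M"
  shows "tm_val \<nu> s ` tms \<nu> n \<subseteq> universe M"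
proof
  fix a assume "a \<in> tm_val \<nu> s ` tms \<nu> n"
  then obtain t where "t \<in> tms \<nu> n" "a = tm_val \<nu> s t" by blast
  with assms show "a \<in> universe M" by (cases t) (auto simp: tms_def ran_def)
qed

text \<open>The invariant of path conditions: it is what \<open>forall_upto n\<close> requires in
  order to produce a sentence.\<close>

definition good_fm :: "'a rel_structure \<Rightarrow> 'a naming \<Rightarrow> nat \<Rightarrow> fm \<Rightarrow> bool" where
  "good_fm M \<nu> n \<phi> \<longleftrightarrow> wf_fm M \<nu> \<phi> \<and> free_vars \<phi> \<subseteq> {..<n}"

lemma good_fm_simps [simp]:
  "good_fm M \<nu> n (Eq t u) \<longleftrightarrow> t \<in> tms \<nu> n \<and> u \<in> tms \<nu> n"
  "good_fm M \<nu> n (Rel k r ts) \<longleftrightarrow> r \<in> rels M k \<and> length ts = k \<and> set ts \<subseteq> tms \<nu> n"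
  "good_fm M \<nu> n (Neg \<phi>) \<longleftrightarrow> good_fm M \<nu> n \<phi>"
  "good_fm M \<nu> n (Conj \<phi> \<psi>) \<longleftrightarrow> good_fm M \<nu> n \<phi> \<and> good_fm M \<nu> n \<psi>"
  "good_fm M \<nu> n (Imp \<phi> \<psi>) \<longleftrightarrow> good_fm M \<nu> n \<phi> \<and> good_fm M \<nu> n \<psi>"
  "good_fm M \<nu> n true_fm"
  by (auto simp: good_fm_def tms_def)

lemma good_eq_fm:
  "set_val v \<subseteq> tms \<nu> n \<Longrightarrow> set_val w \<subseteq> tms \<nu> n \<Longrightarrow> good_fm M \<nu> n (eq_fm v w)"
  by (induction v arbitrary: w) (auto split: val.split)

lemma forall_upto_sentence:
  assumes "good_fm M \<nu> n \<phi>"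
  shows "forall_upto n \<phi> \<in> sentences M \<nu>"
proof -
  have "wf_fm M \<nu> (forall_upto k \<phi>) \<and> free_vars (forall_upto k \<phi>) = free_vars \<phi> - {..<k}" for k
    using assms by (induction k) (auto simp: good_fm_def less_Suc_eq)
  then show ?thesis using assms by (auto simp: sentences_def good_fm_def)
qed

text \<open>The agreement of \<open>s'\<close> with \<open>s\<close> from \<open>n\<close> on is
  there for the induction, where \<open>s\<close> changes at \<open>n\<close>. It disappears in
  \<open>models_forall_upto\<close>, which ranges over all \<open>s\<close>.\<close>

lemma sat_forall_upto:
  "sat M \<nu> s (forall_upto n \<phi>) \<longleftrightarrow>
     (\<forall>s'. (\<forall>i<n. s' i \<in> universe M) \<and> (\<forall>i\<ge>n. s' i = s i) \<longrightarrow> sat M \<nu> s' \<phi>)"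
proof (induction n arbitrary: s)
  case 0
  have "s' = s" if "\<forall>i. s' i = s i" for s' using that by auto
  then show ?case by auto
next
  case (Suc n)
  have "(\<exists>a\<in>universe M. (\<forall>i<n. s' i \<in> universe M) \<and> (\<forall>i\<ge>n. s' i = (s(n := a)) i)) \<longleftrightarrow>
      (\<forall>i<Suc n. s' i \<in> universe M) \<and> (\<forall>i\<ge>Suc n. s' i = s i)" (is "?L s' \<longleftrightarrow> ?R s'") for s'
  proof
    assume "(\<forall>i<Suc n. s' i \<in> universe M) \<and> (\<forall>i\<ge>Suc n. s' i = s i)"
    then show "\<exists>a\<in>universe M. (\<forall>i<n. s' i \<in> universe M) \<and> (\<forall>i\<ge>n. s' i = (s(n := a)) i)"
      by (intro bexI[of _ "s' n"]) (auto simp: Suc_le_eq)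
  qed (auto simp: less_Suc_eq)
  note * = this
  have "sat M \<nu> s (forall_upto (Suc n) \<phi>) \<longleftrightarrow> (\<forall>s'. ?L s' \<longrightarrow> sat M \<nu> s' \<phi>)"
    unfolding forall_upto.simps sat.simps Suc.IH by blast
  then show ?case unfolding * .
qed

lemma models_forall_upto:
  "models M \<nu> (forall_upto n \<phi>) \<longleftrightarrow> (\<forall>s. (\<forall>i<n. s i \<in> universe M) \<longrightarrow> sat M \<nu> s \<phi>)"
  unfolding models_def sat_forall_upto by blast

section \<open>Soundness of symbolic execution\<close>

lemma run_prime_not_test:
  "\<not> (p = EqTest \<or> (\<exists>k r. p = RelTest k r)) \<Longrightarrow> run_prime A \<kappa> p (v, s) = (prime_fun A \<kappa> p v, s)"
  by (cases p) (simp_all add: run_prime_def)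

lemma map_val_truth_val [simp]: "map_val f (truth_val b) = truth_val b"
  by (simp add: truth_val_def)

text \<open>Naturality: a prime function that does not inspect atoms commutes with evaluating the
  terms at the leaves. It fails for \<open>EqTest\<close>, as different terms may have equal values.
  The typing of \<open>v\<close> excludes values outside the patterns of
  \<open>prime_fun\<close>.\<close>

lemma map_val_prime_fun:
  assumes "\<not> (p = EqTest \<or> (\<exists>k r. p = RelTest k r))" "wf_prime M \<nu> p" "v \<in> elems A (prime_dom p)"
  shows "map_val (tm_val \<nu> s) (prime_fun A (cst_naming \<nu>) p v) =
    prime_fun M \<nu> p (map_val (tm_val \<nu> s) v)"
  using assms by (cases p) (auto simp: cst_naming_def)

text \<open>Brings both kinds of tests into one form: each branches on some atomic formula whose
  truth under an assignment is the actual outcome. Later proofs need no distinction between equality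
  and relations.\<close>

lemma test_fm:
  assumes "p = EqTest \<or> (\<exists>k r. p = RelTest k r)" "wf_prime M \<nu> p"
    and "v \<in> elems (tm_structure M \<nu> n) (prime_dom p)"
  obtains \<theta> where "\<And>s. run_prime A \<kappa> p (v, s) = branch \<theta> s" "good_fm M \<nu> n \<theta>"
    "\<And>\<sigma>. prime_fun M \<nu> p (map_val (tm_val \<nu> \<sigma>) v) = truth_val (sat M \<nu> \<sigma> \<theta>)"
  using assms(1)
proof
  assume p: "p = EqTest"
  with assms(3) obtain t u where "v = Tup (Atom t) (Atom u)" "t \<in> tms \<nu> n" "u \<in> tms \<nu> n" by auto
  with p show ?thesis
    by (intro that[of "Eq t u"]) (auto simp: run_prime_def)
next
  assume "\<exists>k r. p = RelTest k r"
  then obtain k r where p: "p = RelTest k r" by blast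
  have "length (components v) = k \<and> set (components v) \<subseteq> tms \<nu> n"
    using components_atoms_pow[of v "tm_structure M \<nu> n" k] assms(3) p by simp
  with p assms(2) show ?thesis
    by (intro that[of "Rel k r (components v)"])
      (auto simp: run_prime_def components_map_val)
qed

lemma truth_val_elems: "truth_val b \<in> elems M (One \<oplus> One)"
  by (simp add: truth_val_def)

lemma run_prime_sound:
  assumes "wf_prime M \<nu> p" "v \<in> elems (tm_structure M \<nu> n) (prime_dom p)" "good_fm M \<nu> n \<phi>"
    and "run_prime (tm_structure M \<nu> n) (cst_naming \<nu>) p (v, b, \<phi>) = (v', b', \<phi>')"
  shows "v' \<in> elems (tm_structure M \<nu> n) (prime_cod p)" "good_fm M \<nu> n \<phi>'"
    "sat M \<nu> s \<phi>' \<Longrightarrow> sat M \<nu> s \<phi> \<and>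
      map_val (tm_val \<nu> s) v' = prime_fun M \<nu> p (map_val (tm_val \<nu> s) v)"
proof -
  have "v' \<in> elems (tm_structure M \<nu> n) (prime_cod p) \<and> good_fm M \<nu> n \<phi>' \<and>
    (sat M \<nu> s \<phi>' \<longrightarrow> sat M \<nu> s \<phi> \<and>
      map_val (tm_val \<nu> s) v' = prime_fun M \<nu> p (map_val (tm_val \<nu> s) v))"
  proof (cases "p = EqTest \<or> (\<exists>k r. p = RelTest k r)")
    case True
    obtain \<theta> where "run_prime (tm_structure M \<nu> n) (cst_naming \<nu>) p (v, b, \<phi>) = branch \<theta> (b, \<phi>)"
      "good_fm M \<nu> n \<theta>"
      "\<And>\<sigma>. prime_fun M \<nu> p (map_val (tm_val \<nu> \<sigma>) v) = truth_val (sat M \<nu> \<sigma> \<theta>)"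
      using test_fm[OF True assms(1,2)] by blast
    moreover have "prime_cod p = One \<oplus> One" using True by auto
    ultimately show ?thesis
      using assms(3,4) truth_val_elems
      by (auto simp: branch_def split: if_splits)
  next
    case False
    then show ?thesis
      using assms prime_fun_elems[of "cst_naming \<nu>" "tm_structure M \<nu> n" p v]
        map_val_prime_fun[OF False assms(1,2), of s]
      by (auto simp: run_prime_not_test ran_cst_naming)
  qed
  then show "v' \<in> elems (tm_structure M \<nu> n) (prime_cod p)" "good_fm M \<nu> n \<phi>'"
    "sat M \<nu> s \<phi>' \<Longrightarrow> sat M \<nu> s \<phi> \<and>
      map_val (tm_val \<nu> s) v' = prime_fun M \<nu> p (map_val (tm_val \<nu> s) v)"
    by blast+
qed

text \<open>Under an assignment satisfying the final path condition, every outcome chosen by the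
  oracle is the real one. Path conditions only grow, so the final one implies those of all
  intermediate stages; the claim \<open>sat M \<nu> s \<phi>\<close> is what allows consecutive runs
  to be chained.\<close>

lemma run_sound:
  assumes "wf_mexp M \<nu> e" "v \<in> elems (tm_structure M \<nu> n) (mdom e)" "good_fm M \<nu> n \<phi>"
    and "run (tm_structure M \<nu> n) (cst_naming \<nu>) e (v, b, \<phi>) = (v', b', \<phi>')"
  shows "v' \<in> elems (tm_structure M \<nu> n) (mcod e) \<and> good_fm M \<nu> n \<phi>' \<and>
    (sat M \<nu> s \<phi>' \<longrightarrow> sat M \<nu> s \<phi> \<and>
      map_val (tm_val \<nu> s) v' = mexp_fun M \<nu> e (map_val (tm_val \<nu> s) v))"
  using assms
proof (induction e arbitrary: v b \<phi> v' b' \<phi>')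
  case (Prime p)
  then show ?case using run_prime_sound[of M \<nu> p v n \<phi> b v' b' \<phi>'] by auto
next
  case (Comp g f)
  obtain u c \<psi> where "run (tm_structure M \<nu> n) (cst_naming \<nu>) f (v, b, \<phi>) = (u, c, \<psi>)"
    by (metis prod_cases3)
  with Comp.prems Comp.IH(2)[OF _ _ _ this] Comp.IH(1)[of u \<psi> c v' b' \<phi>'] show ?case by auto
next
  case (PlusMap f g)
  from PlusMap.prems(2) consider x where "v = Lft x" "x \<in> elems (tm_structure M \<nu> n) (mdom f)"
    | y where "v = Rgt y" "y \<in> elems (tm_structure M \<nu> n) (mdom g)" by auto
  then show ?case
  proof cases
    case 1
    obtain u c \<psi> where "run (tm_structure M \<nu> n) (cst_naming \<nu>) f (x, b, \<phi>) = (u, c, \<psi>)"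
      by (metis prod_cases3)
    with 1 PlusMap.prems PlusMap.IH(1)[OF _ _ _ this] show ?thesis by auto
  next
    case 2
    obtain u c \<psi> where "run (tm_structure M \<nu> n) (cst_naming \<nu>) g (y, b, \<phi>) = (u, c, \<psi>)"
      by (metis prod_cases3)
    with 2 PlusMap.prems PlusMap.IH(2)[OF _ _ _ this] show ?thesis by auto
  qed
next
  case (TensorMap f g)
  from TensorMap.prems(2) obtain x y where v: "v = Tup x y"
    "x \<in> elems (tm_structure M \<nu> n) (mdom f)" "y \<in> elems (tm_structure M \<nu> n) (mdom g)" by auto
  obtain u c \<psi> where g: "run (tm_structure M \<nu> n) (cst_naming \<nu>) g (y, b, \<phi>) = (u, c, \<psi>)"
    by (metis prod_cases3)
  obtain u' c' \<psi>' where "run (tm_structure M \<nu> n) (cst_naming \<nu>) f (x, c, \<psi>) = (u', c', \<psi>')"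
    by (metis prod_cases3)
  with v TensorMap.prems TensorMap.IH(2)[OF _ _ _ g] TensorMap.IH(1)[OF _ _ _ this] g
  show ?case by auto
next
  case (WithMap f g)
  from WithMap.prems(2) obtain x y where v: "v = Tup x y"
    "x \<in> elems (tm_structure M \<nu> n) (mdom f)" "y \<in> elems (tm_structure M \<nu> n) (mdom g)" by auto
  obtain u c \<psi> where g: "run (tm_structure M \<nu> n) (cst_naming \<nu>) g (y, b, \<phi>) = (u, c, \<psi>)"
    by (metis prod_cases3)
  obtain u' c' \<psi>' where "run (tm_structure M \<nu> n) (cst_naming \<nu>) f (x, c, \<psi>) = (u', c', \<psi>')"
    by (metis prod_cases3)
  with v WithMap.prems WithMap.IH(2)[OF _ _ _ g] WithMap.IH(1)[OF _ _ _ this] g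
  show ?case by auto
qed

section \<open>Counting oracle digits, and completeness\<close>

lemma list_encode_bounds: "0 < list_encode [t, a]" "a + b < list_encode [t, a, b]"
proof -
  have "a + b < lcons a (lcons b 0)"
    using add_less_lcons[of a "lcons b 0"] add_less_lcons[of b 0] by linarith
  then show "a + b < list_encode [t, a, b]"
    unfolding list_encode_lcons using add_less_lcons[of t "lcons a (lcons b 0)"] by linarith
qed (simp add: list_encode_lcons)

text \<open>Shows that the code can serve as a count of digits: one for a prime function, and at
  least the sum of the counts of both parts for a combinator. In \<open>code_lty_bounds\<close> the
  sum type is strict, as it spends a digit of its own.\<close>

lemma code_mexp_bounds:
  "0 < code_mexp (Prime p)"
  "code_mexp f + code_mexp g \<le> code_mexp (Comp g f)"
  "code_mexp f + code_mexp g \<le> code_mexp (PlusMap f g)"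
  "code_mexp f + code_mexp g \<le> code_mexp (TensorMap f g)"
  "code_mexp f + code_mexp g \<le> code_mexp (WithMap f g)"
  using list_encode_bounds(2)[of "code_mexp f" "code_mexp g"]
    list_encode_bounds(2)[of "code_mexp g" "code_mexp f" 1]
  by (auto simp: list_encode_bounds(1) less_imp_le add.commute simp del: list_encode.simps)

lemma code_lty_bounds:
  "code_lty X + code_lty Y < code_lty (X \<oplus> Y)"
  "code_lty X + code_lty Y \<le> code_lty (X \<sqinter> Y)"
  "code_lty X + code_lty Y \<le> code_lty (X \<otimes> Y)"
  using list_encode_bounds(2)[of "code_lty X" "code_lty Y"]
  by (auto simp: less_imp_le simp del: list_encode.simps)

text \<open>If \<open>c\<close> is left of an oracle \<open>b\<close> after at most \<open>k\<close>
  digits have been read, then \<open>b < 2 ^ k * Suc c\<close>. In this reading the lemma adds up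
  the digits of two consecutive runs.\<close>

lemma power2_mult_bound:
  fixes b c d :: nat
  assumes "b < 2 ^ k * Suc c" "c < 2 ^ l * Suc d" "k + l \<le> m"
  shows "b < 2 ^ m * Suc d"
proof -
  have "b < 2 ^ k * Suc c" by fact
  also have "\<dots> \<le> 2 ^ k * (2 ^ l * Suc d)" using assms(2) by (intro mult_left_mono) auto
  also have "\<dots> = 2 ^ (k + l) * Suc d" by (simp add: power_add algebra_simps)
  also have "\<dots> \<le> 2 ^ m * Suc d" using assms(3) by (intro mult_right_mono power_increasing) auto
  finally show ?thesis .
qed

lemma power2_mult_mono:
  fixes b d :: nat
  assumes "b < 2 ^ k * Suc d" "k \<le> m"
  shows "b < 2 ^ m * Suc d"
  using power2_mult_bound[of b k d 0 d m] assms by simp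

lemma less_power2_mult: "b < 2 ^ k * Suc b"
  using mult_right_mono[of 1 "2 ^ k" "Suc b"] by simp

text \<open>The oracle is assembled backwards: the digits for the last stage are put in front of the
  prescribed rest \<open>b'\<close>, then those for the stage before. This works because the output
  and the path condition are fixed by \<open>s\<close> alone, before \<open>b'\<close> is
  chosen.\<close>

lemma run_complete:
  assumes "wf_mexp M \<nu> e" "v \<in> elems (tm_structure M \<nu> n) (mdom e)" "good_fm M \<nu> n \<phi>" "sat M \<nu> s \<phi>"
  shows "\<exists>v' \<phi>'. sat M \<nu> s \<phi>' \<and> (\<forall>b'. \<exists>b < 2 ^ code_mexp e * Suc b'.
    run (tm_structure M \<nu> n) (cst_naming \<nu>) e (v, b, \<phi>) = (v', b', \<phi>'))"
  using assms
proof (induction e arbitrary: v \<phi>)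
  case (Prime p)
  have pos: "2 * Suc b' \<le> 2 ^ code_mexp (Prime p) * Suc b'" for b'
    using code_mexp_bounds(1)[of p] by (intro mult_right_mono self_le_power) auto
  show ?case
  proof (cases "p = EqTest \<or> (\<exists>k r. p = RelTest k r)")
    case True
    obtain \<theta> where \<theta>: "\<And>s. run_prime (tm_structure M \<nu> n) (cst_naming \<nu>) p (v, s) = branch \<theta> s"
      using test_fm[OF True, where M = M and \<nu> = \<nu> and v = v and n = n]
        Prime.prems(1,2)[unfolded wf_mexp.simps mdom.simps] by blast
    define \<phi>' where "\<phi>' = Conj \<phi> (if sat M \<nu> s \<theta> then \<theta> else Neg \<theta>)"
    \<comment> \<open>The true outcome becomes the lowest digit, so that halving leaves
      \<open>b'\<close>. The code of a prime function is positive, which leaves room for this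
      digit.\<close>
    have "\<exists>b < 2 ^ code_mexp (Prime p) * Suc b'. run (tm_structure M \<nu> n) (cst_naming \<nu>) (Prime p)
        (v, b, \<phi>) = (truth_val (sat M \<nu> s \<theta>), b', \<phi>')" for b'
      using pos[of b']
      by (intro exI[of _ "2 * b' + of_bool (sat M \<nu> s \<theta>)"])
        (auto simp: \<theta> branch_def \<phi>'_def of_bool_def simp del: code_mexp.simps)
    moreover have "sat M \<nu> s \<phi>'" using Prime.prems(4) by (simp add: \<phi>'_def)
    ultimately show ?thesis by blast
  next
    case False
    have "b' < 2 ^ code_mexp (Prime p) * Suc b'" for b'
      by (rule less_power2_mult)
    with False Prime.prems(4) show ?thesis
      by (auto simp: run_prime_not_test simp del: code_mexp.simps)
  qed
next
  case (Comp g f)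
  obtain u \<psi> where f: "sat M \<nu> s \<psi>" "\<And>c. \<exists>b < 2 ^ code_mexp f * Suc c.
      run (tm_structure M \<nu> n) (cst_naming \<nu>) f (v, b, \<phi>) = (u, c, \<psi>)"
    using Comp.IH(2)[of v \<phi>] Comp.prems by auto
  with run_sound[of M \<nu> f v n \<phi>] Comp.prems
  have "u \<in> elems (tm_structure M \<nu> n) (mdom g)" "good_fm M \<nu> n \<psi>" by fastforce+
  then obtain v' \<phi>' where g: "sat M \<nu> s \<phi>'" "\<And>b'. \<exists>c < 2 ^ code_mexp g * Suc b'.
      run (tm_structure M \<nu> n) (cst_naming \<nu>) g (u, c, \<psi>) = (v', b', \<phi>')"
    using Comp.IH(1)[of u \<psi>] Comp.prems f(1) by auto
  have "\<exists>b < 2 ^ code_mexp (Comp g f) * Suc b'.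
      run (tm_structure M \<nu> n) (cst_naming \<nu>) (Comp g f) (v, b, \<phi>) = (v', b', \<phi>')" for b'
  proof -
    obtain c where c: "c < 2 ^ code_mexp g * Suc b'"
      "run (tm_structure M \<nu> n) (cst_naming \<nu>) g (u, c, \<psi>) = (v', b', \<phi>')" using g(2) by blast
    obtain b where b: "b < 2 ^ code_mexp f * Suc c"
      "run (tm_structure M \<nu> n) (cst_naming \<nu>) f (v, b, \<phi>) = (u, c, \<psi>)" using f(2) by blast
    from power2_mult_bound[OF b(1) c(1) code_mexp_bounds(2)] b(2) c(2) show ?thesis
      by (auto simp del: code_mexp.simps)
  qed
  with g(1) show ?case by blast
next
  case (PlusMap f g)
  have le: "code_mexp f \<le> code_mexp (PlusMap f g)" "code_mexp g \<le> code_mexp (PlusMap f g)"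
    using code_mexp_bounds(3)[of f g] by linarith+
  from PlusMap.prems(2) consider x where "v = Lft x" "x \<in> elems (tm_structure M \<nu> n) (mdom f)"
    | y where "v = Rgt y" "y \<in> elems (tm_structure M \<nu> n) (mdom g)" by auto
  then show ?case
  proof cases
    case 1
    obtain u \<psi> where f: "sat M \<nu> s \<psi>" "\<And>c. \<exists>b < 2 ^ code_mexp f * Suc c.
        run (tm_structure M \<nu> n) (cst_naming \<nu>) f (x, b, \<phi>) = (u, c, \<psi>)"
      using PlusMap.IH(1)[of x \<phi>] PlusMap.prems 1 by auto
    have "\<exists>b < 2 ^ code_mexp (PlusMap f g) * Suc b'.
        run (tm_structure M \<nu> n) (cst_naming \<nu>) (PlusMap f g) (v, b, \<phi>) = (Lft u, b', \<psi>)" for b'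
    proof -
      obtain b where "b < 2 ^ code_mexp f * Suc b'"
        "run (tm_structure M \<nu> n) (cst_naming \<nu>) f (x, b, \<phi>) = (u, b', \<psi>)" using f(2) by blast
      with power2_mult_mono[OF _ le(1), of b b'] 1 show ?thesis
        by (auto simp del: code_mexp.simps)
    qed
    with f(1) show ?thesis by blast
  next
    case 2
    obtain u \<psi> where g: "sat M \<nu> s \<psi>" "\<And>c. \<exists>b < 2 ^ code_mexp g * Suc c.
        run (tm_structure M \<nu> n) (cst_naming \<nu>) g (y, b, \<phi>) = (u, c, \<psi>)"
      using PlusMap.IH(2)[of y \<phi>] PlusMap.prems 2 by auto
    have "\<exists>b < 2 ^ code_mexp (PlusMap f g) * Suc b'.
        run (tm_structure M \<nu> n) (cst_naming \<nu>) (PlusMap f g) (v, b, \<phi>) = (Rgt u, b', \<psi>)" for b'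
    proof -
      obtain b where "b < 2 ^ code_mexp g * Suc b'"
        "run (tm_structure M \<nu> n) (cst_naming \<nu>) g (y, b, \<phi>) = (u, b', \<psi>)" using g(2) by blast
      with power2_mult_mono[OF _ le(2), of b b'] 2 show ?thesis
        by (auto simp del: code_mexp.simps)
    qed
    with g(1) show ?thesis by blast
  qed
next
  case (TensorMap f g)
  from TensorMap.prems(2) obtain x y where v: "v = Tup x y"
    "x \<in> elems (tm_structure M \<nu> n) (mdom f)" "y \<in> elems (tm_structure M \<nu> n) (mdom g)" by auto
  obtain y' \<psi> where g: "sat M \<nu> s \<psi>" "\<And>c. \<exists>b < 2 ^ code_mexp g * Suc c.
      run (tm_structure M \<nu> n) (cst_naming \<nu>) g (y, b, \<phi>) = (y', c, \<psi>)"
    using TensorMap.IH(2)[of y \<phi>] TensorMap.prems v by auto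
  with run_sound[of M \<nu> g y n \<phi>] TensorMap.prems v
  have "good_fm M \<nu> n \<psi>" by fastforce
  then obtain x' \<phi>' where f: "sat M \<nu> s \<phi>'" "\<And>b'. \<exists>c < 2 ^ code_mexp f * Suc b'.
      run (tm_structure M \<nu> n) (cst_naming \<nu>) f (x, c, \<psi>) = (x', b', \<phi>')"
    using TensorMap.IH(1)[of x \<psi>] TensorMap.prems v g(1) by auto
  have "\<exists>b < 2 ^ code_mexp (TensorMap f g) * Suc b'.
      run (tm_structure M \<nu> n) (cst_naming \<nu>) (TensorMap f g) (v, b, \<phi>) = (Tup x' y', b', \<phi>')" for b'
  proof -
    obtain c where c: "c < 2 ^ code_mexp f * Suc b'"
      "run (tm_structure M \<nu> n) (cst_naming \<nu>) f (x, c, \<psi>) = (x', b', \<phi>')" using f(2) by blast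
    obtain b where b: "b < 2 ^ code_mexp g * Suc c"
      "run (tm_structure M \<nu> n) (cst_naming \<nu>) g (y, b, \<phi>) = (y', c, \<psi>)" using g(2) by blast
    have "code_mexp g + code_mexp f \<le> code_mexp (TensorMap f g)"
      using code_mexp_bounds(4)[of f g] by linarith
    from power2_mult_bound[OF b(1) c(1) this] b(2) c(2) v(1) show ?thesis
      by (auto simp del: code_mexp.simps)
  qed
  with f(1) show ?case by blast
next
  case (WithMap f g)
  from WithMap.prems(2) obtain x y where v: "v = Tup x y"
    "x \<in> elems (tm_structure M \<nu> n) (mdom f)" "y \<in> elems (tm_structure M \<nu> n) (mdom g)" by auto
  obtain y' \<psi> where g: "sat M \<nu> s \<psi>" "\<And>c. \<exists>b < 2 ^ code_mexp g * Suc c.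
      run (tm_structure M \<nu> n) (cst_naming \<nu>) g (y, b, \<phi>) = (y', c, \<psi>)"
    using WithMap.IH(2)[of y \<phi>] WithMap.prems v by auto
  with run_sound[of M \<nu> g y n \<phi>] WithMap.prems v
  have "good_fm M \<nu> n \<psi>" by fastforce
  then obtain x' \<phi>' where f: "sat M \<nu> s \<phi>'" "\<And>b'. \<exists>c < 2 ^ code_mexp f * Suc b'.
      run (tm_structure M \<nu> n) (cst_naming \<nu>) f (x, c, \<psi>) = (x', b', \<phi>')"
    using WithMap.IH(1)[of x \<psi>] WithMap.prems v g(1) by auto
  have "\<exists>b < 2 ^ code_mexp (WithMap f g) * Suc b'.
      run (tm_structure M \<nu> n) (cst_naming \<nu>) (WithMap f g) (v, b, \<phi>) = (Tup x' y', b', \<phi>')" for b'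
  proof -
    obtain c where c: "c < 2 ^ code_mexp f * Suc b'"
      "run (tm_structure M \<nu> n) (cst_naming \<nu>) f (x, c, \<psi>) = (x', b', \<phi>')" using f(2) by blast
    obtain b where b: "b < 2 ^ code_mexp g * Suc c"
      "run (tm_structure M \<nu> n) (cst_naming \<nu>) g (y, b, \<phi>) = (y', c, \<psi>)" using g(2) by blast
    have "code_mexp g + code_mexp f \<le> code_mexp (WithMap f g)"
      using code_mexp_bounds(5)[of f g] by linarith
    from power2_mult_bound[OF b(1) c(1) this] b(2) c(2) v(1) show ?thesis
      by (auto simp del: code_mexp.simps)
  qed
  with f(1) show ?case by blast
qed

lemma sym_elems:
  assumes "sym_val X (b, n) = (v, b', n')"
  shows "n \<le> n' \<and> v \<in> elems (tm_structure M \<nu> n') X"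
  using assms
proof (induction X arbitrary: b n v b' n')
  case (With X Y)
  obtain y c m where y: "sym_val Y (b, n) = (y, c, m)" by (metis prod_cases3)
  obtain x c' m' where x: "sym_val X (c, m) = (x, c', m')" by (metis prod_cases3)
  from With.IH(2)[OF y] With.IH(1)[OF x] elems_mono[of "tm_structure M \<nu> m" "tm_structure M \<nu> m'" Y]
    With.prems x y
  show ?case using tms_mono[of m m' \<nu>] by auto
next
  case (Tensor X Y)
  obtain y c m where y: "sym_val Y (b, n) = (y, c, m)" by (metis prod_cases3)
  obtain x c' m' where x: "sym_val X (c, m) = (x, c', m')" by (metis prod_cases3)
  from Tensor.IH(2)[OF y] Tensor.IH(1)[OF x] elems_mono[of "tm_structure M \<nu> m" "tm_structure M \<nu> m'" Y]
    Tensor.prems x y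
  show ?case using tms_mono[of m m' \<nu>] by auto
next
  case (Plus X Y)
  then show ?case
    by (cases "sym_val X (b div 2, n)"; cases "sym_val Y (b div 2, n)") (auto split: if_splits)
qed (auto simp: tms_def)

text \<open>The atoms of \<open>w\<close> are stored in fresh variables from \<open>n\<close> on,
  while \<open>s\<close> is kept below \<open>n\<close> so that values produced earlier retain their
  meaning. The oracle is assembled backwards from an arbitrary rest, as in
  \<open>run_complete\<close>.\<close>

lemma sym_complete:
  assumes "w \<in> elems M X"
  shows "\<exists>v n' s'. (\<forall>i<n. s' i = s i) \<and> (\<forall>i. n \<le> i \<and> i < n' \<longrightarrow> s' i \<in> universe M) \<and>
    map_val (tm_val \<nu> s') v = w \<and> (\<forall>b'. \<exists>b < 2 ^ code_lty X * Suc b'. sym_val X (b, n) = (v, b', n'))"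
  using assms
proof (induction X arbitrary: w n s)
  case One
  then show ?case
    by (intro exI[of _ Unit] exI[of _ n] exI[of _ s]) (auto simp: less_power2_mult simp del: code_lty.simps mult_Suc_right)
next
  case Atoms
  then obtain a where "w = Atom a" "a \<in> universe M" by auto
  then show ?case
    by (intro exI[of _ "Atom (Var n)"] exI[of _ "Suc n"] exI[of _ "s(n := a)"])
      (auto simp: less_power2_mult simp del: code_lty.simps mult_Suc_right)
next
  case (Plus X Y)
  have le: "2 ^ code_lty X * Suc b' * 2 \<le> 2 ^ code_lty (X \<oplus> Y) * Suc b'"
    "2 ^ code_lty Y * Suc b' * 2 \<le> 2 ^ code_lty (X \<oplus> Y) * Suc b'" for b'
  proof -
    have "(2 :: nat) ^ (code_lty X + 1) \<le> 2 ^ code_lty (X \<oplus> Y)"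
      "(2 :: nat) ^ (code_lty Y + 1) \<le> 2 ^ code_lty (X \<oplus> Y)"
      using code_lty_bounds(1)[of X Y] by (intro power_increasing; linarith)+
    from mult_right_mono[OF this(1), of "Suc b'"] mult_right_mono[OF this(2), of "Suc b'"]
    show "2 ^ code_lty X * Suc b' * 2 \<le> 2 ^ code_lty (X \<oplus> Y) * Suc b'"
      "2 ^ code_lty Y * Suc b' * 2 \<le> 2 ^ code_lty (X \<oplus> Y) * Suc b'"
      by (simp_all add: algebra_simps del: code_lty.simps)
  qed
  from Plus.prems consider x where "w = Lft x" "x \<in> elems M X" | y where "w = Rgt y" "y \<in> elems M Y"
    by auto
  then show ?case
  proof cases
    case 1
    obtain v n' s' where IH: "\<forall>i<n. s' i = s i" "\<forall>i. n \<le> i \<and> i < n' \<longrightarrow> s' i \<in> universe M"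
      "map_val (tm_val \<nu> s') v = x" "\<And>b'. \<exists>b < 2 ^ code_lty X * Suc b'. sym_val X (b, n) = (v, b', n')"
      using Plus.IH(1)[OF 1(2), of n s] by blast
    \<comment> \<open>An odd oracle selects the left summand, hence the witness
      \<open>2 * b + 1\<close>; for the right summand it is \<open>2 * b\<close>. The spare factor 2
      is provided by \<open>le\<close>.\<close>
    have "\<exists>b < 2 ^ code_lty (X \<oplus> Y) * Suc b'. sym_val (X \<oplus> Y) (b, n) = (Lft v, b', n')" for b'
    proof -
      obtain b where "b < 2 ^ code_lty X * Suc b'" "sym_val X (b, n) = (v, b', n')" using IH(4) by blast
      with le(1)[of b'] show ?thesis
        by (intro exI[of _ "2 * b + 1"]) (auto simp del: code_lty.simps)
    qed
    with IH 1 show ?thesis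
      by (intro exI[of _ "Lft v"] exI[of _ n'] exI[of _ s']) simp
  next
    case 2
    obtain v n' s' where IH: "\<forall>i<n. s' i = s i" "\<forall>i. n \<le> i \<and> i < n' \<longrightarrow> s' i \<in> universe M"
      "map_val (tm_val \<nu> s') v = y" "\<And>b'. \<exists>b < 2 ^ code_lty Y * Suc b'. sym_val Y (b, n) = (v, b', n')"
      using Plus.IH(2)[OF 2(2), of n s] by blast
    have "\<exists>b < 2 ^ code_lty (X \<oplus> Y) * Suc b'. sym_val (X \<oplus> Y) (b, n) = (Rgt v, b', n')" for b'
    proof -
      obtain b where "b < 2 ^ code_lty Y * Suc b'" "sym_val Y (b, n) = (v, b', n')" using IH(4) by blast
      with le(2)[of b'] show ?thesis
        by (intro exI[of _ "2 * b"]) (auto simp del: code_lty.simps)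
    qed
    with IH 2 show ?thesis
      by (intro exI[of _ "Rgt v"] exI[of _ n'] exI[of _ s']) simp
  qed
next
  case (With X Y)
  from With.prems obtain x y where w: "w = Tup x y" "x \<in> elems M X" "y \<in> elems M Y" by auto
  obtain vy m t where Y: "\<forall>i<n. t i = s i" "\<forall>i. n \<le> i \<and> i < m \<longrightarrow> t i \<in> universe M"
    "map_val (tm_val \<nu> t) vy = y" "\<And>c. \<exists>b < 2 ^ code_lty Y * Suc c. sym_val Y (b, n) = (vy, c, m)"
    using With.IH(2)[OF w(3), of n s] by blast
  obtain vx n' s' where X: "\<forall>i<m. s' i = t i" "\<forall>i. m \<le> i \<and> i < n' \<longrightarrow> s' i \<in> universe M"
    "map_val (tm_val \<nu> s') vx = x" "\<And>b'. \<exists>c < 2 ^ code_lty X * Suc b'. sym_val X (c, m) = (vx, b', n')"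
    using With.IH(1)[OF w(2), of m t] by blast
  have vy: "n \<le> m" "vy \<in> elems (tm_structure M \<nu> m) Y" using Y(4)[of 0] sym_elems by blast+
  \<comment> \<open>The right component was produced first and mentions only variables below
    \<open>m\<close>; assigning those of the left component, from \<open>m\<close> on, does not
    change its value.\<close>
  have "map_val (tm_val \<nu> s') vy = y"
    using map_val_cong_elems[OF vy(2), of "tm_val \<nu> s'" "tm_val \<nu> t"] X(1) Y(3)
    by (metis tm_val_cong universe_tm_structure)
  moreover have "\<exists>b < 2 ^ code_lty (X \<sqinter> Y) * Suc b'. sym_val (X \<sqinter> Y) (b, n) = (Tup vx vy, b', n')" for b'
  proof -
    obtain c where c: "c < 2 ^ code_lty X * Suc b'" "sym_val X (c, m) = (vx, b', n')" using X(4) by blast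
    obtain b where b: "b < 2 ^ code_lty Y * Suc c" "sym_val Y (b, n) = (vy, c, m)" using Y(4) by blast
    have "code_lty Y + code_lty X \<le> code_lty (X \<sqinter> Y)" using code_lty_bounds(2)[of X Y] by linarith
    from power2_mult_bound[OF b(1) c(1) this] b(2) c(2) show ?thesis
      by (auto simp del: code_lty.simps)
  qed
  moreover have "\<forall>i<n. s' i = s i" using X(1) Y(1) vy(1) by auto
  moreover have "\<forall>i. n \<le> i \<and> i < n' \<longrightarrow> s' i \<in> universe M" using X(1,2) Y(2) by (metis not_le)
  ultimately show ?case using X(3) w(1)
    by (intro exI[of _ "Tup vx vy"] exI[of _ n'] exI[of _ s']) simp
next
  case (Tensor X Y)
  from Tensor.prems obtain x y where w: "w = Tup x y" "x \<in> elems M X" "y \<in> elems M Y" by auto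
  obtain vy m t where Y: "\<forall>i<n. t i = s i" "\<forall>i. n \<le> i \<and> i < m \<longrightarrow> t i \<in> universe M"
    "map_val (tm_val \<nu> t) vy = y" "\<And>c. \<exists>b < 2 ^ code_lty Y * Suc c. sym_val Y (b, n) = (vy, c, m)"
    using Tensor.IH(2)[OF w(3), of n s] by blast
  obtain vx n' s' where X: "\<forall>i<m. s' i = t i" "\<forall>i. m \<le> i \<and> i < n' \<longrightarrow> s' i \<in> universe M"
    "map_val (tm_val \<nu> s') vx = x" "\<And>b'. \<exists>c < 2 ^ code_lty X * Suc b'. sym_val X (c, m) = (vx, b', n')"
    using Tensor.IH(1)[OF w(2), of m t] by blast
  have vy: "n \<le> m" "vy \<in> elems (tm_structure M \<nu> m) Y" using Y(4)[of 0] sym_elems by blast+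
  have "map_val (tm_val \<nu> s') vy = y"
    using map_val_cong_elems[OF vy(2), of "tm_val \<nu> s'" "tm_val \<nu> t"] X(1) Y(3)
    by (metis tm_val_cong universe_tm_structure)
  moreover have "\<exists>b < 2 ^ code_lty (X \<otimes> Y) * Suc b'. sym_val (X \<otimes> Y) (b, n) = (Tup vx vy, b', n')" for b'
  proof -
    obtain c where c: "c < 2 ^ code_lty X * Suc b'" "sym_val X (c, m) = (vx, b', n')" using X(4) by blast
    obtain b where b: "b < 2 ^ code_lty Y * Suc c" "sym_val Y (b, n) = (vy, c, m)" using Y(4) by blast
    have "code_lty Y + code_lty X \<le> code_lty (X \<otimes> Y)" using code_lty_bounds(3)[of X Y] by linarith
    from power2_mult_bound[OF b(1) c(1) this] b(2) c(2) show ?thesis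
      by (auto simp del: code_lty.simps)
  qed
  moreover have "\<forall>i<n. s' i = s i" using X(1) Y(1) vy(1) by auto
  moreover have "\<forall>i. n \<le> i \<and> i < n' \<longrightarrow> s' i \<in> universe M" using X(1,2) Y(2) by (metis not_le)
  ultimately show ?case using X(3) w(1)
    by (intro exI[of _ "Tup vx vy"] exI[of _ n'] exI[of _ s']) simp
qed

text \<open>From left to right, soundness gives the sentences for all oracles, bounded or not. From
  right to left, completeness turns an element \<open>w\<close> into an assignment together with
  bounded oracles whose path conditions are both true there, so the sentence yields equality at
  \<open>w\<close>.\<close>

lemma morphism_eq_iff:
  assumes "ran \<nu> \<subseteq> universe M" "wf_mexp M \<nu> e1" "wf_mexp M \<nu> e2"
  shows "morphism M \<nu> e1 = morphism M \<nu> e2 \<longleftrightarrow> mdom e1 = mdom e2 \<and> mcod e1 = mcod e2 \<and>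
    (\<forall>b < 2 ^ code_lty (mdom e1). \<forall>b1 < 2 ^ code_mexp e1. \<forall>b2 < 2 ^ code_mexp e2.
       models M \<nu> (agree_fm M \<nu> e1 e2 b b1 b2))"
proof (cases "mdom e1 = mdom e2 \<and> mcod e1 = mcod e2")
  case False
  then show ?thesis by (auto simp: morphism_def)
next
  case True
  have "morphism M \<nu> e1 = morphism M \<nu> e2 \<longleftrightarrow>
      (\<forall>w\<in>elems M (mdom e1). mexp_fun M \<nu> e1 w = mexp_fun M \<nu> e2 w)"
    using True by (auto simp: morphism_def restrict_def fun_eq_iff)
  also have "\<dots> \<longleftrightarrow> (\<forall>b < 2 ^ code_lty (mdom e1). \<forall>b1 < 2 ^ code_mexp e1. \<forall>b2 < 2 ^ code_mexp e2.
       models M \<nu> (agree_fm M \<nu> e1 e2 b b1 b2))"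
  proof
    assume eq: "\<forall>w\<in>elems M (mdom e1). mexp_fun M \<nu> e1 w = mexp_fun M \<nu> e2 w"
    have "models M \<nu> (agree_fm M \<nu> e1 e2 b b1 b2)" for b b1 b2
    proof -
      obtain v c n where v: "sym_val (mdom e1) (b, 0) = (v, c, n)" by (metis prod_cases3)
      let ?A = "tm_structure M \<nu> n" and ?\<kappa> = "cst_naming \<nu>"
      obtain v1 c1 \<phi>1 where 1: "run ?A ?\<kappa> e1 (v, b1, true_fm) = (v1, c1, \<phi>1)" by (metis prod_cases3)
      obtain v2 c2 \<phi>2 where 2: "run ?A ?\<kappa> e2 (v, b2, true_fm) = (v2, c2, \<phi>2)" by (metis prod_cases3)
      have vA: "v \<in> elems ?A (mdom e1)" using sym_elems[OF v] by blast
      have "map_val (tm_val \<nu> s) v1 = map_val (tm_val \<nu> s) v2"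
        if "\<forall>i<n. s i \<in> universe M" "sat M \<nu> s \<phi>1" "sat M \<nu> s \<phi>2" for s
      proof -
        have "map_val (tm_val \<nu> s) v \<in> elems M (mdom e1)"
          using map_val_elems[OF vA] tm_val_universe[OF assms(1), of n s] that(1) by simp
        with eq run_sound[OF assms(2) vA _ 1, of s] run_sound[OF assms(3) _ _ 2, of s] vA True that
        show ?thesis by simp
      qed
      then show ?thesis
        by (simp add: agree_fm_def v 1 2 models_forall_upto)
    qed
    then show "\<forall>b < 2 ^ code_lty (mdom e1). \<forall>b1 < 2 ^ code_mexp e1. \<forall>b2 < 2 ^ code_mexp e2.
       models M \<nu> (agree_fm M \<nu> e1 e2 b b1 b2)" by blast
  next
    assume agree: "\<forall>b < 2 ^ code_lty (mdom e1). \<forall>b1 < 2 ^ code_mexp e1. \<forall>b2 < 2 ^ code_mexp e2.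
       models M \<nu> (agree_fm M \<nu> e1 e2 b b1 b2)"
    show "\<forall>w\<in>elems M (mdom e1). mexp_fun M \<nu> e1 w = mexp_fun M \<nu> e2 w"
    proof
      fix w assume "w \<in> elems M (mdom e1)"
      \<comment> \<open>No variable lies below 0, so the initial assignment is arbitrary.
        Prescribing 0 as the rest of the oracle turns the bound \<open>2 ^ k * Suc 0\<close> into
        \<open>2 ^ k\<close>.\<close>
      from sym_complete[OF this, of 0 undefined \<nu>] obtain v n s b where
        s: "\<forall>i<n. s i \<in> universe M" "map_val (tm_val \<nu> s) v = w"
        and b: "b < 2 ^ code_lty (mdom e1)" "sym_val (mdom e1) (b, 0) = (v, 0, n)"
        by (metis Suc_eq_plus1 add_0 le0 mult.right_neutral One_nat_def)
      let ?A = "tm_structure M \<nu> n" and ?\<kappa> = "cst_naming \<nu>"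
      have vA: "v \<in> elems ?A (mdom e1)" using sym_elems[OF b(2)] by blast
      obtain v1 \<phi>1 b1 where 1: "sat M \<nu> s \<phi>1" "b1 < 2 ^ code_mexp e1"
          "run ?A ?\<kappa> e1 (v, b1, true_fm) = (v1, 0, \<phi>1)"
        using run_complete[OF assms(2) vA, of true_fm s]
        by (metis true_fm_simps(1) good_fm_simps(6) mult.right_neutral One_nat_def)
      have vA': "v \<in> elems ?A (mdom e2)" using vA True by simp
      obtain v2 \<phi>2 b2 where 2: "sat M \<nu> s \<phi>2" "b2 < 2 ^ code_mexp e2"
          "run ?A ?\<kappa> e2 (v, b2, true_fm) = (v2, 0, \<phi>2)"
        using run_complete[OF assms(3) vA', of true_fm s]
        by (metis true_fm_simps(1) good_fm_simps(6) mult.right_neutral One_nat_def)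
      from agree b(1) 1(2) 2(2) have "models M \<nu> (agree_fm M \<nu> e1 e2 b b1 b2)" by blast
      then have "map_val (tm_val \<nu> s) v1 = map_val (tm_val \<nu> s) v2"
        using s(1) 1(1) 2(1) by (simp add: agree_fm_def b(2) 1(3) 2(3) models_forall_upto)
      with run_sound[OF assms(2) vA _ 1(3), of s] run_sound[OF assms(3) vA' _ 2(3), of s] 1(1) 2(1) s(2)
      show "mexp_fun M \<nu> e1 w = mexp_fun M \<nu> e2 w" by simp
    qed
  qed
  finally show ?thesis using True by simp
qed

text \<open>The algorithm for the theory is specified on sentences only, so each query must be one.
  Equal domains ensure that the input generated for \<open>e1\<close> is also well-typed for
  \<open>e2\<close>.\<close>

lemma agree_fm_sentence:
  assumes "wf_mexp M \<nu> e1" "wf_mexp M \<nu> e2" "mdom e1 = mdom e2"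
  shows "agree_fm M \<nu> e1 e2 b b1 b2 \<in> sentences M \<nu>"
proof -
  obtain v c n where v: "sym_val (mdom e1) (b, 0) = (v, c, n)" by (metis prod_cases3)
  let ?A = "tm_structure M \<nu> n" and ?\<kappa> = "cst_naming \<nu>"
  obtain v1 c1 \<phi>1 where 1: "run ?A ?\<kappa> e1 (v, b1, true_fm) = (v1, c1, \<phi>1)" by (metis prod_cases3)
  obtain v2 c2 \<phi>2 where 2: "run ?A ?\<kappa> e2 (v, b2, true_fm) = (v2, c2, \<phi>2)" by (metis prod_cases3)
  have vA: "v \<in> elems ?A (mdom e1)" using sym_elems[OF v] by blast
  have "v1 \<in> elems ?A (mcod e1)" "good_fm M \<nu> n \<phi>1" "v2 \<in> elems ?A (mcod e2)" "good_fm M \<nu> n \<phi>2"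
    using run_sound[OF assms(1) vA _ 1] run_sound[OF assms(2) _ _ 2] vA assms(3) by auto
  then show ?thesis
    using set_val_elems[of v1 ?A "mcod e1"] set_val_elems[of v2 ?A "mcod e2"]
    by (auto simp: agree_fm_def v 1 2 intro!: forall_upto_sentence good_eq_fm)
qed

section \<open>Symbolic execution of coded expressions\<close>

declare list_encode.simps [simp del] list_encode_lcons [simp]

abbreviation node0 :: "nat \<Rightarrow> nat" where "node0 t \<equiv> lcons t 0"
abbreviation node1 :: "nat \<Rightarrow> nat \<Rightarrow> nat" where "node1 t a \<equiv> lcons t (lcons a 0)"
abbreviation node2 :: "nat \<Rightarrow> nat \<Rightarrow> nat \<Rightarrow> nat" where "node2 t a b \<equiv> lcons t (lcons a (lcons b 0))"
abbreviation node3 :: "nat \<Rightarrow> nat \<Rightarrow> nat \<Rightarrow> nat \<Rightarrow> nat" where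
  "node3 t a b c \<equiv> lcons t (lcons a (lcons b (lcons c 0)))"

section \<open>Arithmetic counterparts of the symbolic operations\<close>

primrec code_val :: "tm val \<Rightarrow> nat" where
  "code_val Unit = node0 0"
| "code_val (Atom t) = node1 1 (code_tm t)"
| "code_val (Lft x) = node1 2 (code_val x)"
| "code_val (Rgt x) = node1 3 (code_val x)"
| "code_val (Tup x y) = node2 4 (code_val x) (code_val y)"

definition code_state :: "tm val \<times> nat \<times> fm \<Rightarrow> nat" where
  "code_state = (\<lambda>(v, b, \<phi>). pair (code_val v) (pair b (code_fm \<phi>)))"

definition atoms_pow_code :: "nat \<Rightarrow> nat" where
  "atoms_pow_code = rec_nat (node0 0) (\<lambda>n r. if n = 0 then node0 1 else node2 4 (node0 1) r)"

text \<open>The tags are those of \<open>code_prime\<close> and \<open>code_lty\<close>; a missing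
  argument harmlessly reads as 0. The last branch collects the tags 3, 12, 13, 17, and in
  \<open>prime_cod_code\<close> the tags 3, 10, 15, 18.\<close>

definition prime_dom_code :: "nat \<Rightarrow> nat" where
  "prime_dom_code p = (let t = lhd p; x = arg1 p; y = arg2 p; z = arg3 p in
     if t = 0 then node2 4 (node0 1) (node0 1)
     else if t = 1 then node0 0
     else if t = 2 then atoms_pow_code x
     else if t = 4 \<or> t = 10 \<or> t = 11 then node2 4 x y
     else if t = 5 then node2 4 x (node2 4 y z)
     else if t = 6 then node2 4 (node2 4 x y) z
     else if t = 7 then node2 2 x y
     else if t = 8 then node2 2 x (node2 2 y z)
     else if t = 9 then node2 2 (node2 2 x y) z
     else if t = 14 then y
     else if t = 15 then node2 2 x x
     else if t = 16 then node2 4 x (node2 2 y z)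
     else if t = 18 \<or> t = 19 then node2 3 x y
     else if t = 20 then node2 4 x (node2 3 y z)
     else if t = 21 then node2 3 x (node2 2 y z)
     else x)"

definition prime_cod_code :: "nat \<Rightarrow> nat" where
  "prime_cod_code p = (let t = lhd p; x = arg1 p; y = arg2 p; z = arg3 p in
     if t = 0 \<or> t = 2 then node2 2 (node0 0) (node0 0)
     else if t = 1 then node0 1
     else if t = 4 then node2 4 y x
     else if t = 5 then node2 4 (node2 4 x y) z
     else if t = 6 then node2 4 x (node2 4 y z)
     else if t = 7 then node2 2 y x
     else if t = 8 then node2 2 (node2 2 x y) z
     else if t = 9 then node2 2 x (node2 2 y z)
     else if t = 11 \<or> t = 19 then y
     else if t = 12 then node2 4 x (node0 0)
     else if t = 13 \<or> t = 14 then node2 2 x y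
     else if t = 16 then node2 2 (node2 4 x y) (node2 4 x z)
     else if t = 17 then node2 3 x x
     else if t = 20 then node2 3 (node2 4 x y) (node2 4 x z)
     else if t = 21 then node2 2 (node2 3 x y) (node2 3 x z)
     else x)"

text \<open>\<open>r\<close> belongs to the second argument and \<open>r'\<close> to the first. The
  tags are translated because the tensor and \<open>With\<close> have 3 and 4 in
  \<open>code_mexp\<close> but 4 and 3 in \<open>code_lty\<close>. At a \<open>Prime\<close> node
  the recursion also descends into the code of the prime function, and these results are
  discarded.\<close>

definition mdom_code :: "nat \<Rightarrow> nat" where
  "mdom_code = srec (\<lambda>_ _. 0) (\<lambda>_ _ _. 0) (\<lambda>_ x r r'.
     if lhd x = 0 then prime_dom_code (arg1 x)
     else if lhd x = 1 then r
     else node2 (if lhd x = 2 then 2 else if lhd x = 3 then 4 else 3) r' r) 0"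

definition mcod_code :: "nat \<Rightarrow> nat" where
  "mcod_code = srec (\<lambda>_ _. 0) (\<lambda>_ _ _. 0) (\<lambda>_ x r r'.
     if lhd x = 0 then prime_cod_code (arg1 x)
     else if lhd x = 1 then r'
     else node2 (if lhd x = 2 then 2 else if lhd x = 3 then 4 else 3) r' r) 0"

text \<open>The parameter pairs the oracle with the next fresh variable. At a sum both summands are
  tried from the same state and the digit selects a result; at a product the first component starts
  in the state left by the second.\<close>

definition sym_val_code :: "nat \<Rightarrow> nat \<Rightarrow> nat" where
  "sym_val_code = srec
     (\<lambda>p x. if lhd x = 2 then pair (pfst p div 2) (psnd p) else p)
     (\<lambda>p x r. if lhd x = 2 then pair (pfst p div 2) (psnd p) else psnd r)
     (\<lambda>p x r r'.
       if lhd x = 0 then pair (node0 0) p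
       else if lhd x = 1 then pair (node1 1 (node1 0 (psnd p))) (pair (pfst p) (Suc (psnd p)))
       else if lhd x = 2 then
         if odd (pfst p) then pair (node1 2 (pfst r')) (psnd r') else pair (node1 3 (pfst r)) (psnd r)
       else pair (node2 4 (pfst r') (pfst r)) (psnd r'))"

text \<open>The parameter is an accumulator, filled from the right; this avoids concatenation of
  coded lists.\<close>

definition components_code :: "nat \<Rightarrow> nat \<Rightarrow> nat" where
  "components_code = srec (\<lambda>p x. p) (\<lambda>p x r. if lhd x = 4 then r else p)
     (\<lambda>p x r r'. if lhd x = 0 then p else if lhd x = 1 then lcons (arg1 x) p else r')"

definition true_fm_code :: nat where "true_fm_code = code_fm true_fm"

text \<open>The recursion is over the first value of the equation, and the parameter is the second
  one, taken apart in parallel. The arguments are therefore swapped in comparison with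
  \<open>eq_fm\<close>.\<close>

definition eq_fm_code :: "nat \<Rightarrow> nat \<Rightarrow> nat" where
  "eq_fm_code = srec (\<lambda>p x. arg2 p) (\<lambda>p x r. arg1 p)
     (\<lambda>p x r r'.
       if lhd p \<noteq> lhd x then node1 2 true_fm_code
       else if lhd x = 0 then true_fm_code
       else if lhd x = 1 then node2 0 (arg1 x) (arg1 p)
       else if lhd x = 4 then node2 3 r' r
       else r')"

definition branch_code :: "nat \<Rightarrow> nat \<Rightarrow> nat" where
  "branch_code \<theta> s = pair (if odd (pfst s) then node1 2 (node0 0) else node1 3 (node0 0))
     (pair (pfst s div 2) (node2 3 (psnd s) (if odd (pfst s) then \<theta> else node1 2 \<theta>)))"

text \<open>A constant is turned into its own name, as \<open>cst_naming\<close> prescribes, so the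
  function behind the code does not depend on \<open>\<nu>\<close>. Reassociation of sums reuses
  parts of the input: \<open>Lft (Lft x)\<close> is \<open>Lft\<close> of the whole input
  \<open>Lft x\<close>.\<close>

definition prime_fun_code :: "nat \<Rightarrow> nat \<Rightarrow> nat" where
  "prime_fun_code p v = (let t = lhd p; x = arg1 v; y = arg2 v; i = lhd v; j = lhd y in
     if t = 1 then node1 1 (node1 1 (arg1 p))
     else if t = 4 then node2 4 y x
     else if t = 5 then node2 4 (node2 4 x (arg1 y)) (arg2 y)
     else if t = 6 then node2 4 (arg1 x) (node2 4 (arg2 x) y)
     else if t = 7 then (if i = 2 then node1 3 x else node1 2 x)
     else if t = 8 then
       (if i = 2 then node1 2 v else if lhd x = 2 then node1 2 (node1 3 (arg1 x)) else x)
     else if t = 9 then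
       (if i = 3 then node1 3 v else if lhd x = 2 then x else node1 3 (node1 2 (arg1 x)))
     else if t = 10 \<or> t = 15 \<or> t = 18 then x
     else if t = 11 \<or> t = 19 then y
     else if t = 12 then node2 4 v (node0 0)
     else if t = 13 then node1 2 v
     else if t = 14 then node1 3 v
     else if t = 16 \<or> t = 21 then
       (if j = 2 then node1 2 (node2 4 x (arg1 y)) else node1 3 (node2 4 x (arg1 y)))
     else if t = 17 then node2 4 v v
     else if t = 20 then node2 4 (node2 4 x (arg1 y)) (node2 4 x (arg2 y))
     else v)"

definition run_prime_code :: "nat \<Rightarrow> nat \<Rightarrow> nat" where
  "run_prime_code p s = (let c = components_code 0 (pfst s) in
     if lhd p = 0 then branch_code (node2 0 (lhd c) (lhd (ltl c))) (psnd s)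
     else if lhd p = 2 then branch_code (node3 1 (arg1 p) (arg2 p) c) (psnd s)
     else pair (prime_fun_code p (pfst s)) (psnd s))"

text \<open>Here the dependence of one recursive call on the other is essential: for a composition
  the result of the inner run is the parameter of the outer run. For \<open>PlusMap\<close> both
  branches are executed, and the tag of the input decides which result counts.\<close>

definition run_code :: "nat \<Rightarrow> nat \<Rightarrow> nat" where
  "run_code = srec
     (\<lambda>p x. if lhd x = 1 then p
       else if lhd x = 2 then pair (arg1 (pfst p)) (psnd p)
       else pair (arg2 (pfst p)) (psnd p))
     (\<lambda>p x r. if lhd x = 1 then r
       else if lhd x = 2 then pair (arg1 (pfst p)) (psnd p)
       else pair (arg1 (pfst p)) (psnd r))
     (\<lambda>p x r r'.
       if lhd x = 0 then run_prime_code (arg1 x) p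
       else if lhd x = 1 then r'
       else if lhd x = 2 then
         if lhd (pfst p) = 2 then pair (node1 2 (pfst r')) (psnd r') else pair (node1 3 (pfst r)) (psnd r)
       else pair (node2 4 (pfst r') (pfst r)) (psnd r'))"

definition forall_upto_code :: "nat \<Rightarrow> nat \<Rightarrow> nat" where
  "forall_upto_code n \<phi> = rec_nat \<phi> (\<lambda>k r. node2 6 k r) n"

definition agree_fm_code :: "nat \<Rightarrow> nat \<Rightarrow> nat \<Rightarrow> nat \<Rightarrow> nat \<Rightarrow> nat" where
  "agree_fm_code c1 c2 b b1 b2 =
     (let s = sym_val_code (pair b 0) (mdom_code c1);
        r1 = run_code (pair (pfst s) (pair b1 true_fm_code)) c1;
        r2 = run_code (pair (pfst s) (pair b2 true_fm_code)) c2
      in forall_upto_code (psnd (psnd s))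
           (node2 5 (node2 3 (psnd (psnd r1)) (psnd (psnd r2))) (eq_fm_code (pfst r2) (pfst r1))))"

section \<open>Correctness of the arithmetic counterparts\<close>

lemma atoms_pow_code: "atoms_pow_code k = code_lty (atoms_pow k)"
  by (induction k rule: atoms_pow.induct) (simp_all add: atoms_pow_code_def)

lemma prime_dom_code: "prime_dom_code (code_prime p) = code_lty (prime_dom p)"
  by (cases p) (simp_all add: prime_dom_code_def atoms_pow_code Let_def)

lemma prime_cod_code: "prime_cod_code (code_prime p) = code_lty (prime_cod p)"
  by (cases p) (simp_all add: prime_cod_code_def Let_def)

lemma mdom_code: "mdom_code (code_mexp e) = code_lty (mdom e)"
  by (induction e) (simp_all add: mdom_code_def srec_pos Let_def prime_dom_code)

lemma mcod_code: "mcod_code (code_mexp e) = code_lty (mcod e)"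
  by (induction e) (simp_all add: mcod_code_def srec_pos Let_def prime_cod_code)

lemma sym_val_code:
  "sym_val X (b, n) = (v, b', n') \<Longrightarrow>
    sym_val_code (pair b n) (code_lty X) = pair (code_val v) (pair b' n')"
proof (induction X arbitrary: b n v b' n')
  case (Plus X Y)
  then show ?case
    by (cases "sym_val X (b div 2, n)"; cases "sym_val Y (b div 2, n)")
      (auto simp: sym_val_code_def srec_pos Let_def split: if_splits)
next
  case (With X Y)
  then show ?case
    by (auto simp: sym_val_code_def srec_pos Let_def apfst_def map_prod_def split: prod.splits)
next
  case (Tensor X Y)
  then show ?case
    by (auto simp: sym_val_code_def srec_pos Let_def apfst_def map_prod_def split: prod.splits)
qed (auto simp: sym_val_code_def srec_pos Let_def)

lemma components_code:
  "components_code (list_encode acc) (code_val v) = list_encode (map code_tm (components v) @ acc)"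
  by (induction v arbitrary: acc) (simp_all add: components_code_def srec_pos Let_def)

lemma eq_fm_code: "eq_fm_code (code_val w) (code_val v) = code_fm (eq_fm v w)"
  by (induction v arbitrary: w)
    (case_tac w; simp add: eq_fm_code_def srec_pos Let_def true_fm_code_def)+

lemma branch_code: "branch_code (code_fm \<theta>) (pair b (code_fm \<phi>)) = code_state (branch \<theta> (b, \<phi>))"
  by (simp add: branch_code_def branch_def code_state_def truth_val_def)

lemma prime_fun_code:
  assumes "\<not> (p = EqTest \<or> (\<exists>k r. p = RelTest k r))" "wf_prime M \<nu> p" "v \<in> elems A (prime_dom p)"
  shows "prime_fun_code (code_prime p) (code_val v) = code_val (prime_fun A (cst_naming \<nu>) p v)"
  using assms by (cases p) (auto simp: prime_fun_code_def cst_naming_def Let_def)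

lemma run_prime_code:
  assumes "wf_prime M \<nu> p" "v \<in> elems A (prime_dom p)"
  shows "run_prime_code (code_prime p) (code_state (v, b, \<phi>)) =
    code_state (run_prime A (cst_naming \<nu>) p (v, b, \<phi>))"
proof (cases "p = EqTest \<or> (\<exists>k r. p = RelTest k r)")
  case True
  have c: "components_code 0 (code_val v) = list_encode (map code_tm (components v))"
    using components_code[of "[]" v] by simp
  from True show ?thesis
  proof
    assume p: "p = EqTest"
    with assms(2) obtain t u where "v = Tup (Atom t) (Atom u)" by auto
    with c p show ?thesis
      using branch_code[of "Eq t u" b \<phi>]
      by (simp add: run_prime_code_def run_prime_def code_state_def)
  next
    assume "\<exists>k r. p = RelTest k r"
    then obtain k r where p: "p = RelTest k r" by blast
    with c show ?thesis
      using branch_code[of "Rel k r (components v)" b \<phi>]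
      by (simp add: run_prime_code_def run_prime_def code_state_def)
  qed
next
  case False
  then have "lhd (code_prime p) \<noteq> 0" "lhd (code_prime p) \<noteq> 2" by (cases p; simp)+
  with False prime_fun_code[OF False assms] show ?thesis
    by (simp add: run_prime_not_test run_prime_code_def code_state_def)
qed

lemma run_code_Comp:
  "run_code p (node2 1 c d) = run_code (run_code p d) c"
  by (simp add: run_code_def srec_pos Let_def)

lemma run_code_PlusMap:
  "run_code (pair (node1 2 x) s) (node2 2 c d) =
     pair (node1 2 (pfst (run_code (pair x s) c))) (psnd (run_code (pair x s) c))"
  "run_code (pair (node1 3 x) s) (node2 2 c d) =
     pair (node1 3 (pfst (run_code (pair x s) d))) (psnd (run_code (pair x s) d))"
  by (simp_all add: run_code_def srec_pos Let_def)

lemma run_code_pairs: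
  assumes "t = 3 \<or> t = 4"
  shows "run_code (pair (node2 4 x y) s) (node2 t c d) =
    (let r = run_code (pair y s) d; r' = run_code (pair x (psnd r)) c
     in pair (node2 4 (pfst r') (pfst r)) (psnd r'))"
  using assms by (auto simp: run_code_def srec_pos[of "node2 t c d"] srec_pos Let_def)

text \<open>On ill-typed values \<open>prime_fun\<close> and its arithmetic version need not
  correspond, so typing is part of the induction; \<open>run_sound\<close> passes it on to
  intermediate values.\<close>

lemma run_code:
  assumes "wf_mexp M \<nu> e" "v \<in> elems (tm_structure M \<nu> n) (mdom e)" "good_fm M \<nu> n \<phi>"
  shows "run_code (code_state (v, b, \<phi>)) (code_mexp e) =
    code_state (run (tm_structure M \<nu> n) (cst_naming \<nu>) e (v, b, \<phi>))"
  using assms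
proof (induction e arbitrary: v b \<phi>)
  case (Prime p)
  then show ?case
    using run_prime_code[of M \<nu> p v "tm_structure M \<nu> n" b \<phi>]
    by (simp add: run_code_def srec_pos[of "node1 0 (code_prime p)"] Let_def)
next
  case (Comp g f)
  obtain u c \<psi> where f: "run (tm_structure M \<nu> n) (cst_naming \<nu>) f (v, b, \<phi>) = (u, c, \<psi>)"
    by (metis prod_cases3)
  have "u \<in> elems (tm_structure M \<nu> n) (mdom g)" "good_fm M \<nu> n \<psi>"
    using run_sound[OF _ _ _ f] Comp.prems by auto
  with f Comp show ?case by (simp add: run_code_Comp[unfolded One_nat_def])
next
  case (PlusMap f g)
  from PlusMap.prems(2) consider x where "v = Lft x" "x \<in> elems (tm_structure M \<nu> n) (mdom f)"
    | y where "v = Rgt y" "y \<in> elems (tm_structure M \<nu> n) (mdom g)" by auto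
  then show ?case
  proof cases
    case 1
    with PlusMap.IH(1)[of x \<phi> b] PlusMap.prems show ?thesis
      by (auto simp: code_state_def run_code_PlusMap apfst_def map_prod_def split: prod.splits)
  next
    case 2
    with PlusMap.IH(2)[of y \<phi> b] PlusMap.prems show ?thesis
      by (auto simp: code_state_def run_code_PlusMap apfst_def map_prod_def split: prod.splits)
  qed
next
  case (TensorMap f g)
  from TensorMap.prems(2) obtain x y where v: "v = Tup x y"
    "x \<in> elems (tm_structure M \<nu> n) (mdom f)" "y \<in> elems (tm_structure M \<nu> n) (mdom g)" by auto
  obtain y' c \<psi> where g: "run (tm_structure M \<nu> n) (cst_naming \<nu>) g (y, b, \<phi>) = (y', c, \<psi>)"
    by (metis prod_cases3)
  then have "good_fm M \<nu> n \<psi>" using run_sound[OF _ v(3) _ g] TensorMap.prems by auto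
  with g v TensorMap.prems TensorMap.IH(2)[of y \<phi> b] TensorMap.IH(1)[of x \<psi> c] show ?case
    by (auto simp: code_state_def run_code_pairs Let_def apfst_def map_prod_def split: prod.splits)
next
  case (WithMap f g)
  from WithMap.prems(2) obtain x y where v: "v = Tup x y"
    "x \<in> elems (tm_structure M \<nu> n) (mdom f)" "y \<in> elems (tm_structure M \<nu> n) (mdom g)" by auto
  obtain y' c \<psi> where g: "run (tm_structure M \<nu> n) (cst_naming \<nu>) g (y, b, \<phi>) = (y', c, \<psi>)"
    by (metis prod_cases3)
  then have "good_fm M \<nu> n \<psi>" using run_sound[OF _ v(3) _ g] WithMap.prems by auto
  with g v WithMap.prems WithMap.IH(2)[of y \<phi> b] WithMap.IH(1)[of x \<psi> c] show ?case
    by (auto simp: code_state_def run_code_pairs Let_def apfst_def map_prod_def split: prod.splits)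
qed

lemma forall_upto_code: "forall_upto_code n (code_fm \<phi>) = code_fm (forall_upto n \<phi>)"
  by (induction n) (simp_all add: forall_upto_code_def)

lemma agree_fm_code:
  assumes "wf_mexp M \<nu> e1" "wf_mexp M \<nu> e2" "mdom e1 = mdom e2"
  shows "agree_fm_code (code_mexp e1) (code_mexp e2) b b1 b2 = code_fm (agree_fm M \<nu> e1 e2 b b1 b2)"
proof -
  obtain v c n where v: "sym_val (mdom e1) (b, 0) = (v, c, n)" by (metis prod_cases3)
  let ?A = "tm_structure M \<nu> n" and ?\<kappa> = "cst_naming \<nu>"
  obtain v1 c1 \<phi>1 where 1: "run ?A ?\<kappa> e1 (v, b1, true_fm) = (v1, c1, \<phi>1)" by (metis prod_cases3)
  obtain v2 c2 \<phi>2 where 2: "run ?A ?\<kappa> e2 (v, b2, true_fm) = (v2, c2, \<phi>2)" by (metis prod_cases3)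
  have vA: "v \<in> elems ?A (mdom e1)" "v \<in> elems ?A (mdom e2)" using sym_elems[OF v] assms(3) by auto
  have "run_code (pair (code_val v) (pair b1 true_fm_code)) (code_mexp e1) = code_state (v1, c1, \<phi>1)"
    "run_code (pair (code_val v) (pair b2 true_fm_code)) (code_mexp e2) = code_state (v2, c2, \<phi>2)"
    using run_code[OF assms(1) vA(1), of true_fm b1] run_code[OF assms(2) vA(2), of true_fm b2] 1 2
    by (simp_all add: code_state_def true_fm_code_def)
  moreover have "forall_upto_code n (node2 5 (node2 3 (code_fm \<phi>1) (code_fm \<phi>2)) (code_fm (eq_fm v1 v2)))
      = code_fm (forall_upto n (Imp (Conj \<phi>1 \<phi>2) (eq_fm v1 v2)))"
    using forall_upto_code[of n "Imp (Conj \<phi>1 \<phi>2) (eq_fm v1 v2)"] by simp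
  ultimately show ?thesis
    using sym_val_code[OF v]
    by (simp add: agree_fm_code_def agree_fm_def v 1 2 mdom_code Let_def code_state_def eq_fm_code)
qed

section \<open>Computability of the arithmetic counterparts\<close>

lemma computable_prime_dom_code [computable_intros]:
  "computable f \<Longrightarrow> computable (\<lambda>x. prime_dom_code (f x))"
  unfolding prime_dom_code_def atoms_pow_code_def Let_def by (intro computable_intros)

lemma computable_prime_cod_code [computable_intros]:
  "computable f \<Longrightarrow> computable (\<lambda>x. prime_cod_code (f x))"
  unfolding prime_cod_code_def Let_def by (intro computable_intros)

lemma computable_mdom_code [computable_intros]:
  "computable f \<Longrightarrow> computable (\<lambda>x. mdom_code (f x))"
  unfolding mdom_code_def by (rule computable_srec) (intro computable_intros)+

lemma computable_mcod_code [computable_intros]: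
  "computable f \<Longrightarrow> computable (\<lambda>x. mcod_code (f x))"
  unfolding mcod_code_def by (rule computable_srec) (intro computable_intros)+

lemma computable_sym_val_code [computable_intros]:
  "computable f \<Longrightarrow> computable g \<Longrightarrow> computable (\<lambda>x. sym_val_code (f x) (g x))"
  unfolding sym_val_code_def by (rule computable_srec) (intro computable_intros)+

lemma computable_components_code [computable_intros]:
  "computable f \<Longrightarrow> computable g \<Longrightarrow> computable (\<lambda>x. components_code (f x) (g x))"
  unfolding components_code_def by (rule computable_srec) (intro computable_intros)+

lemma computable_eq_fm_code [computable_intros]:
  "computable f \<Longrightarrow> computable g \<Longrightarrow> computable (\<lambda>x. eq_fm_code (f x) (g x))"
  unfolding eq_fm_code_def by (rule computable_srec) (intro computable_intros)+

lemma computable_branch_code [computable_intros]: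
  "computable f \<Longrightarrow> computable g \<Longrightarrow> computable (\<lambda>x. branch_code (f x) (g x))"
  unfolding branch_code_def by (intro computable_intros)

lemma computable_prime_fun_code [computable_intros]:
  "computable f \<Longrightarrow> computable g \<Longrightarrow> computable (\<lambda>x. prime_fun_code (f x) (g x))"
  unfolding prime_fun_code_def Let_def by (intro computable_intros)

lemma computable_run_prime_code [computable_intros]:
  "computable f \<Longrightarrow> computable g \<Longrightarrow> computable (\<lambda>x. run_prime_code (f x) (g x))"
  unfolding run_prime_code_def Let_def by (intro computable_intros)

lemma computable_run_code [computable_intros]:
  "computable f \<Longrightarrow> computable g \<Longrightarrow> computable (\<lambda>x. run_code (f x) (g x))"
  unfolding run_code_def
  by (rule computable_srec) (intro computable_intros)+

lemma computable_forall_upto_code [computable_intros]: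
  "computable f \<Longrightarrow> computable g \<Longrightarrow> computable (\<lambda>x. forall_upto_code (f x) (g x))"
  unfolding forall_upto_code_def by (intro computable_intros)

lemma computable_agree_fm_code [computable_intros]:
  "computable c1 \<Longrightarrow> computable c2 \<Longrightarrow> computable b \<Longrightarrow> computable b1 \<Longrightarrow> computable b2 \<Longrightarrow>
    computable (\<lambda>x. agree_fm_code (c1 x) (c2 x) (b x) (b1 x) (b2 x))"
  unfolding agree_fm_code_def Let_def by (intro computable_intros)

section \<open>The decision procedure\<close>

theorem theorem17:
  fixes M :: "'a rel_structure" and \<nu> :: "nat \<rightharpoonup> 'a"
  assumes "relational_structure M"
    and "\<And>k. finite (rels M k)"
    and "ran \<nu> \<subseteq> universe M"
    and "decidable_fo_theory M \<nu>"
  shows "decidable_problem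
           (\<lambda>(e1, e2). prod_encode (code_mexp e1, code_mexp e2))
           {(e1, e2). wf_mexp M \<nu> e1 \<and> wf_mexp M \<nu> e2}
           (\<lambda>(e1, e2). morphism M \<nu> e1 = morphism M \<nu> e2)"
proof -
  obtain d where d: "recursive 1 d"
    "\<And>\<phi>. \<phi> \<in> sentences M \<nu> \<Longrightarrow> d [code_fm \<phi>] = (if models M \<nu> \<phi> then 1 else 0)"
    using assms(4) unfolding decidable_fo_theory_def decidable_problem_def by blast
  have "computable (\<lambda>x. d [x])"
    unfolding computable_def
    by (rule recursive.ext[OF d(1)]) (auto simp: length_Suc_conv)
  note computable_d = computable_app[OF this]
  \<comment> \<open>When the types differ, \<open>d\<close> may be asked about numbers that code no
    sentence. It is total, so this is a legitimate computation, and its unspecified answers are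
    overruled by the first two conjuncts.\<close>
  define same where "same x \<longleftrightarrow> mdom_code (pfst x) = mdom_code (psnd x) \<and>
    mcod_code (pfst x) = mcod_code (psnd x) \<and>
    (\<forall>b < 2 ^ mdom_code (pfst x). \<forall>b1 < 2 ^ pfst x. \<forall>b2 < 2 ^ psnd x.
       d [agree_fm_code (pfst x) (psnd x) b b1 b2] = 1)" for x
  have "computable_pred same"
    unfolding same_def by (intro computable_intros computable_d)
  then have "recursive 1 (\<lambda>xs. of_bool (same (xs ! 0)))"
    by (simp add: computable_pred_def computable_def)
  moreover have "same (pair (code_mexp e1) (code_mexp e2)) \<longleftrightarrow> morphism M \<nu> e1 = morphism M \<nu> e2"
    if "wf_mexp M \<nu> e1" "wf_mexp M \<nu> e2" for e1 e2
  proof -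
    have "d [agree_fm_code (code_mexp e1) (code_mexp e2) b b1 b2] = 1 \<longleftrightarrow>
        models M \<nu> (agree_fm M \<nu> e1 e2 b b1 b2)" if "mdom e1 = mdom e2" for b b1 b2
      using d(2)[OF agree_fm_sentence, of e1 e2 b b1 b2] agree_fm_code[of M \<nu> e1 e2 b b1 b2]
        that \<open>wf_mexp M \<nu> e1\<close> \<open>wf_mexp M \<nu> e2\<close> by simp
    then show ?thesis
      unfolding morphism_eq_iff[OF assms(3) that] same_def
      by (auto simp: mdom_code mcod_code inj_eq[OF inj_code_lty] simp del: code_mexp.simps)
  qed
  ultimately show ?thesis
    unfolding decidable_problem_def
    by (intro exI[of _ "\<lambda>xs. of_bool (same (xs ! 0))"]) (auto simp: pair_def[symmetric])
qed

end
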